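(* \begin{enumerate} \item There are infinitely many connected graphs $F$ with $D'(F)\le\frac23\,v(F)+1$. \item For every connected graph $F$, $W'(F)>\frac23\,v(F)-2$. \end{enumerate}
   Context: Graphs are finite and simple; $v(F)$ denotes the number of vertices of $F$. First-order sentences are over the vocabulary $\{\sim,=\}$ (adjacency and equality). A first-order sentence $\Phi$ defines a class of graphs $\mathcal C$ asymptotically over connected graphs if there is an integer $N$ such that for every connected graph $G$ with at least $N$ vertices, $G\models\Phi$ iff $G\in\mathcal C$. For a graph $F$, let $\mathcal C_F$ be the class of graphs containing a (not necessarily induced) subgraph isomorphic to $F$. $D'(F)$ is the minimum quantifier depth of a sentence defining $\mathcal C_F$ asymptotically over connected graphs, and $W'(F)$ is the minimum variable width (number of distinct first-order variables used) of such a sentence. *)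

theory Defs
  imports "Graph_Theory.Graph_Theory"
begin

text \<open>
  A finite simple graph is a \<^const>\<open>pair_graph\<close>: a finite vertex set with a symmetric irreflexive
  set of arcs, the edge between \<open>u\<close> and \<open>v\<close> being the two arcs \<open>(u, v)\<close> and \<open>(v, u)\<close>.
  Vertices are natural numbers, so every finite graph occurs up to isomorphism.
\<close>

type_synonym ngraph = "nat pair_pre_digraph"

abbreviation v_count :: "ngraph \<Rightarrow> nat" where
  "v_count G \<equiv> card (pverts G)"

definition connected_graph :: "ngraph \<Rightarrow> bool" where
  "connected_graph G \<longleftrightarrow> pair_graph G \<and> Digraph_Component.connected (with_proj G)"

definition graph_iso :: "ngraph \<Rightarrow> ngraph \<Rightarrow> bool" where
  "graph_iso F G \<longleftrightarrow> digraph_iso (with_proj F) (with_proj G)"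

definition containing :: "ngraph \<Rightarrow> ngraph set" where
  "containing F =
     {G. pair_graph G \<and>
         (\<exists>H. pair_graph H \<and> subgraph (with_proj H) (with_proj G) \<and> graph_iso F H)}"

text \<open>
  The only atomic formulas are adjacency and equality of variables. There are no propositional
  constants, so every sentence uses at least one variable; otherwise the width of an asymptotically
  trivial class, such as that of the graphs containing the path on three vertices, would be zero.
\<close>

datatype fo =
    Adj nat nat
  | Eq nat nat
  | Neg fo
  | Conj fo fo
  | Disj fo fo
  | Exi nat fo
  | All nat fo

primrec sat :: "ngraph \<Rightarrow> (nat \<Rightarrow> nat) \<Rightarrow> fo \<Rightarrow> bool" where
  "sat G e (Adj x y) \<longleftrightarrow> (e x, e y) \<in> parcs G"
| "sat G e (Eq x y) \<longleftrightarrow> e x = e y"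
| "sat G e (Neg p) \<longleftrightarrow> \<not> sat G e p"
| "sat G e (Conj p q) \<longleftrightarrow> sat G e p \<and> sat G e q"
| "sat G e (Disj p q) \<longleftrightarrow> sat G e p \<or> sat G e q"
| "sat G e (Exi x p) \<longleftrightarrow> (\<exists>a\<in>pverts G. sat G (e(x := a)) p)"
| "sat G e (All x p) \<longleftrightarrow> (\<forall>a\<in>pverts G. sat G (e(x := a)) p)"

primrec free_vars :: "fo \<Rightarrow> nat set" where
  "free_vars (Adj x y) = {x, y}"
| "free_vars (Eq x y) = {x, y}"
| "free_vars (Neg p) = free_vars p"
| "free_vars (Conj p q) = free_vars p \<union> free_vars q"
| "free_vars (Disj p q) = free_vars p \<union> free_vars q"
| "free_vars (Exi x p) = free_vars p - {x}"
| "free_vars (All x p) = free_vars p - {x}"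

primrec all_vars :: "fo \<Rightarrow> nat set" where
  "all_vars (Adj x y) = {x, y}"
| "all_vars (Eq x y) = {x, y}"
| "all_vars (Neg p) = all_vars p"
| "all_vars (Conj p q) = all_vars p \<union> all_vars q"
| "all_vars (Disj p q) = all_vars p \<union> all_vars q"
| "all_vars (Exi x p) = insert x (all_vars p)"
| "all_vars (All x p) = insert x (all_vars p)"

primrec qdepth :: "fo \<Rightarrow> nat" where
  "qdepth (Adj x y) = 0"
| "qdepth (Eq x y) = 0"
| "qdepth (Neg p) = qdepth p"
| "qdepth (Conj p q) = max (qdepth p) (qdepth q)"
| "qdepth (Disj p q) = max (qdepth p) (qdepth q)"
| "qdepth (Exi x p) = Suc (qdepth p)"
| "qdepth (All x p) = Suc (qdepth p)"

definition width :: "fo \<Rightarrow> nat" where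
  "width p = card (all_vars p)"

definition sentence :: "fo \<Rightarrow> bool" where
  "sentence p \<longleftrightarrow> free_vars p = {}"

definition models :: "ngraph \<Rightarrow> fo \<Rightarrow> bool" where
  "models G p \<longleftrightarrow> (\<forall>e. range e \<subseteq> pverts G \<longrightarrow> sat G e p)"

definition defines_asymptotically :: "fo \<Rightarrow> ngraph set \<Rightarrow> bool" where
  "defines_asymptotically p C \<longleftrightarrow>
     sentence p \<and>
     (\<exists>N. \<forall>G. connected_graph G \<and> N \<le> v_count G \<longrightarrow> (models G p \<longleftrightarrow> G \<in> C))"

definition D' :: "ngraph \<Rightarrow> nat" where
  "D' F = (LEAST d. \<exists>p. defines_asymptotically p (containing F) \<and> qdepth p = d)"

definition W' :: "ngraph \<Rightarrow> nat" where
  "W' F = (LEAST w. \<exists>p. defines_asymptotically p (containing F) \<and> width p = w)"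


text \<open>
  Both minima range over nonempty sets: \<open>F\<close>-containment is defined by the existential closure of
  the positive diagram of \<open>F\<close>, with the vertices of \<open>F\<close> as variables.
\<close>

lemma containing_iff:
  assumes F: "pair_graph F" and G: "pair_graph G"
  shows "G \<in> containing F \<longleftrightarrow>
    (\<exists>f. inj_on f (pverts F) \<and> f ` pverts F \<subseteq> pverts G \<and> (\<forall>(u, v)\<in>parcs F. (f u, f v) \<in> parcs G))"
    (is "_ \<longleftrightarrow> (\<exists>f. ?P f)")
proof
  assume "G \<in> containing F"
  then obtain H h where H: "subgraph (with_proj H) (with_proj G)"
    and h: "pre_digraph.digraph_isomorphism (with_proj F) h" "with_proj H = app_iso h (with_proj F)"
    unfolding containing_def graph_iso_def digraph_iso_def by blast
  have eqs: "pverts H = iso_verts h ` pverts F" "parcs H = iso_arcs h ` parcs F"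
    "fst = iso_tail h" "snd = iso_head h"
    using h(2) by (auto simp: with_proj_def app_iso_def)
  have arc: "iso_arcs h a = (iso_verts h (fst a), iso_verts h (snd a))" if "a \<in> parcs F" for a
    using h(1) that unfolding pre_digraph.digraph_isomorphism_def
    by (metis eqs(3,4) prod.collapse with_proj_simps(2,4,5))
  have sub: "pverts H \<subseteq> pverts G" "parcs H \<subseteq> parcs G"
    using H by (auto simp: subgraph_def)
  have "inj_on (iso_verts h) (pverts F)"
    using h(1) unfolding pre_digraph.digraph_isomorphism_def by simp
  moreover have "(iso_verts h u, iso_verts h v) \<in> parcs G" if "(u, v) \<in> parcs F" for u v
    using arc[OF that] sub(2) that unfolding eqs(2) by force
  ultimately have "?P (iso_verts h)" using sub(1) unfolding eqs(1) by blast
  then show "\<exists>f. ?P f" by (intro exI[of _ "iso_verts h"])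
next
  assume "\<exists>f. ?P f"
  then obtain f where f: "?P f" ..
  interpret F: pair_graph F by fact
  interpret G: pair_graph G by fact
  define H where "H = \<lparr>pverts = f ` pverts F, parcs = map_prod f f ` parcs F\<rparr>"
  have H: "pair_graph H"
  proof
    show "symmetric (with_proj H)"
      using F.arcs_symmetric by (auto simp: symmetric_def H_def intro!: symI)
  next
    fix a assume "a \<in> parcs H"
    then obtain x y where xy: "(x, y) \<in> parcs F" and a: "a = (f x, f y)" by (auto simp: H_def)
    have "x \<in> pverts F" "y \<in> pverts F" "x \<noteq> y"
      using F.wellformed'[OF xy] F.no_loops'[OF xy] by auto
    then show "fst a \<noteq> snd a" using f a by (auto dest: inj_onD)
  qed (use F.wellformed' F.pair_finite_verts F.pair_finite_arcs
       in \<open>auto simp: H_def\<close>)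
  interpret H: pair_graph H by (rule H)
  have "subgraph (with_proj H) (with_proj G)"
    using f H.wf_digraph G.wf_digraph by (auto simp: subgraph_def compatible_def H_def)
  moreover have "graph_iso F H"
  proof -
    let ?h = "\<lparr>iso_verts = f, iso_arcs = map_prod f f, iso_head = snd, iso_tail = fst\<rparr>"
    have "inj_on (map_prod f f) (parcs F)"
      using f F.wellformed' by (auto simp: inj_on_def)
    then have "pre_digraph.digraph_isomorphism (with_proj F) ?h"
      using f F.wf_digraph by (auto simp: pre_digraph.digraph_isomorphism_def)
    moreover have "with_proj H = app_iso ?h (with_proj F)"
      by (simp add: with_proj_def app_iso_def H_def)
    ultimately show ?thesis unfolding graph_iso_def digraph_iso_def by blast
  qed
  ultimately show "G \<in> containing F" using G H by (auto simp: containing_def)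
qed

lemma sat_foldr_Conj:
  "sat G e (foldr Conj ps q) \<longleftrightarrow> (\<forall>p\<in>set ps. sat G e p) \<and> sat G e q"
  by (induction ps) auto

lemma sat_foldr_Exi:
  "sat G e (foldr Exi xs p) \<longleftrightarrow>
    (\<exists>e'. e' ` set xs \<subseteq> pverts G \<and> (\<forall>x. x \<notin> set xs \<longrightarrow> e' x = e x) \<and> sat G e' p)"
proof (induction xs arbitrary: e)
  case Nil
  have "e' = e" if "\<forall>x. e' x = e x" for e' using that by auto
  then show ?case by auto
next
  case (Cons x xs)
  show ?case (is "?L \<longleftrightarrow> ?R")
  proof
    assume ?L
    then obtain a e' where a: "a \<in> pverts G" "e' ` set xs \<subseteq> pverts G"
      "\<forall>y. y \<notin> set xs \<longrightarrow> e' y = (e(x := a)) y" "sat G e' p"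
      using Cons.IH by auto
    have "e' x \<in> pverts G" using a by (cases "x \<in> set xs") auto
    with a show ?R by (intro exI[of _ e']) auto
  next
    assume ?R
    then obtain e' where "e' ` set (x # xs) \<subseteq> pverts G"
      "\<forall>y. y \<notin> set (x # xs) \<longrightarrow> e' y = e y" "sat G e' p" by blast
    then have "e' x \<in> pverts G \<and> sat G (e(x := e' x)) (foldr Exi xs p)"
      unfolding Cons.IH by auto
    then show ?L by auto
  qed
qed

lemma free_vars_foldr_Exi: "free_vars (foldr Exi xs p) = free_vars p - set xs"
  by (induction xs) auto

lemma free_vars_foldr_Conj:
  "free_vars (foldr Conj ps q) = (\<Union>p\<in>set ps. free_vars p) \<union> free_vars q"
  by (induction ps) auto

lemma ex_defines_asymptotically:
  assumes "connected_graph F"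
  shows "\<exists>p. defines_asymptotically p (containing F)"
proof -
  have F: "pair_graph F" and ne: "pverts F \<noteq> {}"
    using assms
    by (auto simp: connected_graph_def Digraph_Component.connected_def strongly_connected_def
        mk_symmetric_def)
  interpret F: pair_graph F by fact
  obtain v where v: "v \<in> pverts F" using ne by blast
  obtain vs where vs: "set vs = pverts F" using F.pair_finite_verts finite_list by blast
  obtain as where as: "set as = parcs F" using F.pair_finite_arcs finite_list by blast
  define ps where "ps = map (\<lambda>(x, y). Adj x y) as @
    map (\<lambda>(x, y). Neg (Eq x y)) (filter (\<lambda>(x, y). x \<noteq> y) (List.product vs vs))"
  define p where "p = foldr Exi vs (foldr Conj ps (Eq v v))"
  have "sentence p"
    using F.wellformed' v
    by (auto simp: sentence_def p_def free_vars_foldr_Exi free_vars_foldr_Conj ps_def vs as)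
  moreover have "models G p \<longleftrightarrow> G \<in> containing F" if G: "connected_graph G" for G
  proof -
    have G': "pair_graph G" and "pverts G \<noteq> {}"
      using G
      by (auto simp: connected_graph_def Digraph_Component.connected_def strongly_connected_def
          mk_symmetric_def)
    then obtain b where b: "b \<in> pverts G" by blast
    have body: "sat G f (foldr Conj ps (Eq v v)) \<longleftrightarrow>
        (\<forall>(x, y)\<in>parcs F. (f x, f y) \<in> parcs G) \<and> inj_on f (pverts F)" for f
    proof -
      have "(\<forall>q\<in>set (map (\<lambda>(x, y). Adj x y) as). sat G f q) \<longleftrightarrow>
          (\<forall>(x, y)\<in>parcs F. (f x, f y) \<in> parcs G)"
        by (simp add: as split_beta)
      moreover have "(\<forall>q\<in>set (map (\<lambda>(x, y). Neg (Eq x y))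
          (filter (\<lambda>(x, y). x \<noteq> y) (List.product vs vs))). sat G f q) \<longleftrightarrow> inj_on f (pverts F)"
        by (simp add: vs split_beta inj_on_def) blast
      ultimately show ?thesis
        unfolding sat_foldr_Conj ps_def set_append ball_Un by simp
    qed
    have *: "sat G e p \<longleftrightarrow> (\<exists>f. inj_on f (pverts F) \<and> f ` pverts F \<subseteq> pverts G \<and>
        (\<forall>(u, v)\<in>parcs F. (f u, f v) \<in> parcs G))" (is "_ \<longleftrightarrow> (\<exists>f. ?P f)") for e
    proof
      assume "sat G e p"
      then obtain f where "f ` pverts F \<subseteq> pverts G" "sat G f (foldr Conj ps (Eq v v))"
        unfolding p_def sat_foldr_Exi vs by blast
      then have "?P f" unfolding body by blast
      then show "\<exists>f. ?P f" by (intro exI[of _ f])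
    next
      assume "\<exists>f. ?P f"
      then obtain f where f: "?P f" ..
      define g where "g = (\<lambda>x. if x \<in> pverts F then f x else e x)"
      have "sat G g (foldr Conj ps (Eq v v))"
        unfolding body using f by (auto simp: inj_on_def g_def dest: F.wellformed')
      moreover have "g ` pverts F \<subseteq> pverts G" using f by (auto simp: g_def)
      ultimately show "sat G e p"
        unfolding p_def sat_foldr_Exi vs by (intro exI[of _ g]) (auto simp: g_def)
    qed
    have "range (\<lambda>_ :: nat. b) \<subseteq> pverts G" using b by auto
    moreover have "sat G e p \<longleftrightarrow> G \<in> containing F" for e
      by (rule trans[OF * containing_iff[OF F G', symmetric]])
    ultimately show ?thesis unfolding models_def by meson
  qed
  ultimately show ?thesis unfolding defines_asymptotically_def by blast
qed

end

theory Submission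
  imports Defs
begin

text \<open>
  \<^bold>\<open>Lower bound.\<close> Enlarging a class of twins that already has \<open>k\<close> elements is invisible to \<open>k\<close>
  variables. Hence, if \<open>k\<close> variables define \<open>F\<close>-containment, then \<open>F\<close> embeds into a clique on \<open>k + 1\<close>
  vertices with an arbitrarily long path, an arbitrarily large star, or a path ending in such a star
  attached to it. If \<open>k\<close> is at most \<open>2/3 v(F) - 2\<close>, so that at least \<open>v(F)/3 + 1\<close> vertices lie
  outside the clique, this forces \<open>F\<close> to be a broom: a star with one pendant path. A broom is
  excluded by a complete bipartite graph with a pendant path and a large star attached to a vertex of
  the smaller side: the path of the broom is too long to start there, so the broom has to occupy
  about \<open>2/3 v(F)\<close> twins of the larger side.

  \<^bold>\<open>Upper bound.\<close> Consider the broom with \<open>l\<close> leaves and a path with \<open>q \<ge> 2l\<close> edges. In a large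
  connected graph it is present if every vertex starts a path with \<open>q\<close> edges and some vertex has
  \<open>l + 1\<close> neighbours: look at a vertex of huge degree or, if there is none, at the given vertex and
  one far from it. If some \<open>v\<close> starts no such path, consider a copy with centre \<open>x\<close>. We find vertices \<open>W\<close>
  on its path such that the adjacency to \<open>W\<close> splits the remaining neighbours of \<open>x\<close> in the copy into
  classes of at most \<open>q - |W|\<close> elements. After \<open>x\<close> and \<open>W\<close> have been pebbled, the rest of the path
  and each single class can be pebbled separately within \<open>q + 1\<close> moves, and counting the classes
  recovers the leaves. If there were no such \<open>W\<close>, then leaves could be inserted between consecutive
  neighbours of \<open>x\<close> on the path often enough to give a path with \<open>q\<close> edges that starts at \<open>v\<close>.
\<close>

section \<open>Graphs and paths\<close>

abbreviation nbrs :: "'a pair_pre_digraph \<Rightarrow> 'a \<Rightarrow> 'a set" where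
  "nbrs G v \<equiv> parcs G `` {v}"

lemma pair_graph_arcD:
  assumes "pair_graph G" "(u, v) \<in> parcs G"
  shows "u \<in> pverts G" "v \<in> pverts G" "u \<noteq> v" "(v, u) \<in> parcs G"
proof -
  interpret pair_graph G by fact
  show "u \<in> pverts G" "v \<in> pverts G" "u \<noteq> v" "(v, u) \<in> parcs G"
    using assms(2) wellformed' no_loops' arcs_symmetric by auto
qed

lemma pair_graph_finite:
  assumes "pair_graph G"
  shows "finite (pverts G)" "finite (nbrs G v)"
proof -
  interpret pair_graph G by fact
  show "finite (pverts G)" by (rule pair_finite_verts)
  then show "finite (nbrs G v)" by (rule rev_finite_subset) (auto dest: wellformed')
qed

lemma connected_graph_iff:
  "connected_graph G \<longleftrightarrow> pair_graph G \<and> strongly_connected (with_proj G)"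
proof (cases "pair_graph G")
  case True
  have "mk_symmetric (with_proj G) = G"
    by (rule pair_pre_digraph.equality)
      (use pair_graph_arcD(4)[OF True] in \<open>auto simp: mk_symmetric_def\<close>)
  then show ?thesis using True by (simp add: connected_graph_def connected_def)
qed (simp add: connected_graph_def)

lemma connected_graph_pair_graph: "connected_graph G \<Longrightarrow> pair_graph G"
  by (simp add: connected_graph_def)

lemma connected_graph_reachable:
  "connected_graph G \<Longrightarrow> u \<in> pverts G \<Longrightarrow> v \<in> pverts G \<Longrightarrow> u \<rightarrow>\<^sup>*\<^bsub>with_proj G\<^esub> v"
  by (simp add: connected_graph_iff strongly_connected_def)

lemma connected_graph_closed:
  assumes "connected_graph G" "S \<inter> pverts G \<noteq> {}"
    and closed: "\<And>u v. u \<in> S \<Longrightarrow> (u, v) \<in> parcs G \<Longrightarrow> v \<in> S"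
  shows "pverts G \<subseteq> S"
proof
  interpret pair_graph G using assms(1) by (rule connected_graph_pair_graph)
  fix v assume "v \<in> pverts G"
  moreover obtain u where "u \<in> S" "u \<in> pverts G" using assms(2) by blast
  ultimately have "u \<rightarrow>\<^sup>*\<^bsub>with_proj G\<^esub> v"
    using assms(1) connected_graph_reachable by blast
  then show "v \<in> S" by (induction rule: reachable_induct) (use \<open>u \<in> S\<close> closed in auto)
qed

lemma connected_graph_ex_cut_arc:
  assumes "connected_graph G" "u \<in> pverts G" "w \<in> pverts G" "P u" "\<not> P w"
  obtains y z where "(y, z) \<in> parcs G" "P y" "\<not> P z"
  using connected_graph_closed[OF assms(1), of "Collect P"] assms(2-5) by blast

lemma connected_graph_nbrs_nonempty:
  assumes "connected_graph G" "v \<in> pverts G" "1 < v_count G"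
  shows "nbrs G v \<noteq> {}"
proof -
  have "pverts G \<noteq> {v}" using assms(3) by auto
  then obtain w where "w \<in> pverts G" "w \<noteq> v" using assms(2) by blast
  then show ?thesis using connected_graph_ex_cut_arc[OF assms(1,2), of w "\<lambda>x. x = v"] by auto
qed

definition mk_graph :: "nat \<Rightarrow> (nat \<Rightarrow> nat \<Rightarrow> bool) \<Rightarrow> ngraph" where
  "mk_graph n A = \<lparr>pverts = {..<n}, parcs = {(i, j). i < n \<and> j < n \<and> i \<noteq> j \<and> (A i j \<or> A j i)}\<rparr>"

lemma mk_graph_simps [simp]:
  "pverts (mk_graph n A) = {..<n}"
  "(i, j) \<in> parcs (mk_graph n A) \<longleftrightarrow> i < n \<and> j < n \<and> i \<noteq> j \<and> (A i j \<or> A j i)"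
  by (auto simp: mk_graph_def)

lemma pair_graph_mk_graph [simp]: "pair_graph (mk_graph n A)"
proof
  show "finite (parcs (mk_graph n A))"
    by (rule finite_subset[of _ "{..<n} \<times> {..<n}"]) (auto simp: mk_graph_def)
  show "symmetric (with_proj (mk_graph n A))"
    by (auto simp: symmetric_def intro!: symI)
qed (auto simp: mk_graph_def)

lemma connected_mk_graph:
  assumes "0 < n" and smaller: "\<And>i. 0 < i \<Longrightarrow> i < n \<Longrightarrow> \<exists>j<i. A i j \<or> A j i"
  shows "connected_graph (mk_graph n A)"
proof -
  let ?G = "mk_graph n A"
  interpret pair_graph ?G by simp
  have root: "i \<rightarrow>\<^sup>*\<^bsub>?G\<^esub> 0" if "i < n" for i
    using that
  proof (induction i rule: less_induct)
    case (less i)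
    show ?case
    proof (cases "i = 0")
      case False
      then obtain j where "j < i" "A i j \<or> A j i" using smaller less.prems by blast
      then show ?thesis
        using less adj_reachable_trans[of i j 0] by auto
    qed (use less.prems in simp)
  qed
  then have "i \<rightarrow>\<^sup>*\<^bsub>?G\<^esub> j" if "i < n" "j < n" for i j
    using that symmetric_reachable' reachable_trans by blast
  then show ?thesis
    using assms(1) by (auto simp: connected_graph_iff strongly_connected_def lessThan_empty_iff)
qed

lemma set_vwalk_arcs_subset_iff:
  "set (vwalk_arcs us) \<subseteq> R \<longleftrightarrow> successively (\<lambda>u v. (u, v) \<in> R) us"
  by (induction us rule: vwalk_arcs.induct) auto

lemma vpath_iff_successively:
  fixes G :: "'a pair_pre_digraph"
  shows "vpath us G \<longleftrightarrow>
    us \<noteq> [] \<and> distinct us \<and> set us \<subseteq> pverts G \<and> successively (\<lambda>u v. (u, v) \<in> parcs G) us"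
  by (auto simp: vpath_def vwalk_def set_vwalk_arcs_subset_iff[symmetric])

lemma vpath_closed:
  fixes G :: "'a pair_pre_digraph"
  assumes "vpath us (with_proj G)" "hd us \<in> S"
    and "\<And>u v. u \<in> S \<Longrightarrow> v \<in> set us \<Longrightarrow> (u, v) \<in> parcs G \<Longrightarrow> v \<in> S"
  shows "set us \<subseteq> S"
proof -
  have "successively (\<lambda>u v. (u, v) \<in> parcs G) us"
    using assms(1) by (simp add: vpath_iff_successively)
  then show ?thesis
    using assms(2,3)
  proof (induction us)
    case (Cons x xs)
    show ?case
    proof (cases "xs = []")
      case False
      then have "hd xs \<in> S" using Cons.prems by (auto simp: successively_Cons)
      then show ?thesis using Cons False by (auto simp: successively_Cons)
    qed (use Cons.prems in simp)
  qed simp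
qed

lemma vpath_take:
  fixes G :: "'a pair_pre_digraph"
  assumes "vpath us G" "0 < n"
  shows "vpath (take n us) G"
  using assms successively_append_iff[of _ "take n us" "drop n us"] set_take_subset[of n us]
  by (auto simp: vpath_iff_successively)

lemma vpath_rev:
  assumes "pair_graph G" "vpath us G"
  shows "vpath (rev us) G"
proof -
  interpret pair_graph G by fact
  show ?thesis using assms(2) vwalk_rev_ex sym_arcs by (auto simp: vpath_def)
qed

lemma vwalk_arcs_conv_zip: "vwalk_arcs us = zip us (tl us)"
  by (induction us rule: vwalk_arcs.induct) auto

lemma mem_vwalk_arcs_conv_nth:
  "(u, v) \<in> set (vwalk_arcs us) \<longleftrightarrow> (\<exists>i. Suc i < length us \<and> u = us ! i \<and> v = us ! Suc i)"
  by (auto simp: vwalk_arcs_conv_zip in_set_zip nth_tl less_diff_conv)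

lemma vwalk_arcs_nthI: "Suc i < length us \<Longrightarrow> (us ! i, us ! Suc i) \<in> set (vwalk_arcs us)"
  by (auto simp: mem_vwalk_arcs_conv_nth)

lemma vwalk_arcs_map: "vwalk_arcs (map f us) = map (map_prod f f) (vwalk_arcs us)"
  by (induction us rule: vwalk_arcs.induct) auto

section \<open>Embeddings and brooms\<close>

definition embedding :: "'a pair_pre_digraph \<Rightarrow> 'b pair_pre_digraph \<Rightarrow> ('a \<Rightarrow> 'b) \<Rightarrow> bool" where
  "embedding F G f \<longleftrightarrow> inj_on f (pverts F) \<and> f ` pverts F \<subseteq> pverts G \<and>
     (\<forall>(u, v)\<in>parcs F. (f u, f v) \<in> parcs G)"

lemma containing_iff_embedding:
  "pair_graph F \<Longrightarrow> pair_graph G \<Longrightarrow> G \<in> containing F \<longleftrightarrow> (\<exists>f. embedding F G f)"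
  unfolding containing_iff embedding_def ..

lemma embedding_arc: "embedding F G f \<Longrightarrow> (u, v) \<in> parcs F \<Longrightarrow> (f u, f v) \<in> parcs G"
  by (auto simp: embedding_def)

lemma vpath_embedding:
  assumes "embedding F G f" "vpath us (with_proj F)"
  shows "vpath (map f us) (with_proj G)"
  using assms
  by (auto simp: embedding_def vpath_def vwalk_def vwalk_arcs_map distinct_map intro: inj_on_subset)

definition broom_arcs :: "'a list \<Rightarrow> 'a set \<Rightarrow> 'a rel" where
  "broom_arcs us L =
     set (vwalk_arcs us) \<union> (set (vwalk_arcs us))\<inverse> \<union> {hd us} \<times> L \<union> L \<times> {hd us}"

definition broom_copy :: "'a pair_pre_digraph \<Rightarrow> 'a list \<Rightarrow> 'a set \<Rightarrow> bool" where
  "broom_copy G us L \<longleftrightarrow> vpath us (with_proj G) \<and> L \<subseteq> nbrs G (hd us) - set us"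

definition is_broom :: "'a pair_pre_digraph \<Rightarrow> 'a list \<Rightarrow> 'a set \<Rightarrow> bool" where
  "is_broom F us L \<longleftrightarrow> broom_copy F us L \<and> pverts F = set us \<union> L \<and> parcs F \<subseteq> broom_arcs us L"

lemma nth_broom_arcs_iff:
  assumes "distinct us" "i < length us"
  shows "(us ! i, v) \<in> broom_arcs us {} \<longleftrightarrow>
    0 < i \<and> v = us ! (i - 1) \<or> Suc i < length us \<and> v = us ! Suc i"
  using assms by (cases i) (auto simp: broom_arcs_def mem_vwalk_arcs_conv_nth nth_eq_iff_index_eq)

lemma broom_arcs_subset:
  assumes "pair_graph G" "broom_copy G us L"
  shows "broom_arcs us L \<subseteq> parcs G"
  using assms pair_graph_arcD(4)[OF assms(1)]
  by (auto simp: broom_arcs_def broom_copy_def vpath_def vwalk_def)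

lemma broom_copy_embedding:
  assumes f: "embedding F G f" and F: "pair_graph F" and "broom_copy F us L"
  shows "broom_copy G (map f us) (f ` L)"
proof -
  have us: "vpath us (with_proj F)" "us \<noteq> []" "set us \<subseteq> pverts F"
    and L: "L \<subseteq> nbrs F (hd us) - set us"
    using assms(3) by (auto simp: broom_copy_def vpath_def vwalk_def)
  moreover have "L \<subseteq> pverts F" using L pair_graph_arcD(2)[OF F] by auto
  ultimately show ?thesis
    using f vpath_embedding[OF f us(1)] embedding_arc[OF f]
    by (auto simp: broom_copy_def hd_map embedding_def inj_on_eq_iff subset_iff)
qed

lemma ex_map_eq_extending:
  assumes "distinct us" "length ws = length us"
  obtains f where "map f us = ws" "\<And>v. v \<notin> set us \<Longrightarrow> f v = h v"
proof (rule that)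
  let ?f = "\<lambda>v. if v \<in> set us then the (map_of (zip us ws) v) else h v"
  show "map ?f us = ws"
    by (rule nth_equalityI) (simp_all add: assms map_of_zip_nth)
qed simp

lemma is_broom_embedding:
  assumes F: "is_broom F us R" "finite R" and G: "pair_graph G" and ws: "broom_copy G ws L"
    and sizes: "length ws = length us" "card R \<le> card L"
  obtains f where "embedding F G f"
proof -
  have us: "us \<noteq> []" "distinct us" "R \<inter> set us = {}" and verts_F: "pverts F = set us \<union> R"
    and arcs_F: "parcs F \<subseteq> broom_arcs us R"
    using F(1) by (auto simp: is_broom_def broom_copy_def vpath_iff_successively)
  have ws': "distinct ws" "set ws \<subseteq> pverts G" and L: "L \<subseteq> nbrs G (hd ws) - set ws"
    using ws by (auto simp: broom_copy_def vpath_iff_successively)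
  have "finite L"
    by (rule finite_subset[OF _ pair_graph_finite(2)[OF G, of "hd ws"]]) (use L in auto)
  then obtain h where h: "h ` R \<subseteq> L" "inj_on h R"
    using card_le_inj[OF F(2) _ sizes(2)] by blast
  obtain f where map: "map f us = ws" and off_path: "\<And>v. v \<notin> set us \<Longrightarrow> f v = h v"
    using ex_map_eq_extending[OF us(2) sizes(1)] by blast
  have f_leaf: "f v = h v" if "v \<in> R" for v using off_path us(3) that by blast
  then have images: "f ` set us = set ws" "f ` R \<subseteq> L" using map h(1) by auto
  have "inj_on f (set us)" "inj_on f R"
    using ws'(1) map distinct_map h(2) f_leaf by (blast, simp add: inj_on_def)
  then have "inj_on f (pverts F)" using images L by (auto simp: verts_F inj_on_Un)
  moreover have "L \<subseteq> pverts G" using L pair_graph_arcD(2)[OF G] by auto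
  then have "f ` pverts F \<subseteq> pverts G" using images ws'(2) unfolding verts_F image_Un by blast
  moreover have "(f u, f v) \<in> parcs G" if uv: "(u, v) \<in> broom_arcs us R" for u v
  proof -
    have "f (hd us) = hd ws" using map us(1) by (metis hd_map)
    moreover have "(f u, f v) \<in> set (vwalk_arcs ws)" if "(u, v) \<in> set (vwalk_arcs us)" for u v
      using that by (force simp: map[symmetric] vwalk_arcs_map)
    ultimately have "(f u, f v) \<in> broom_arcs ws L"
      using uv images(2) by (auto simp: broom_arcs_def)
    then show ?thesis using broom_arcs_subset[OF G ws] by blast
  qed
  ultimately have "embedding F G f" using arcs_F by (auto simp: embedding_def)
  then show ?thesis by (rule that)
qed

lemma containing_is_broom_iff:
  assumes F: "pair_graph F" "is_broom F us R" and G: "pair_graph G"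
  shows "G \<in> containing F \<longleftrightarrow>
    (\<exists>ws L. broom_copy G ws L \<and> length ws = length us \<and> card R \<le> card L)"
proof -
  have R: "R \<subseteq> pverts F" "finite R"
    using F pair_graph_finite(1)[OF F(1)] by (auto simp: is_broom_def)
  have "\<exists>ws L. broom_copy G ws L \<and> length ws = length us \<and> card R \<le> card L"
    if f: "embedding F G f" for f
  proof -
    have "broom_copy G (map f us) (f ` R)"
      using broom_copy_embedding[OF f F(1)] F(2) by (simp add: is_broom_def)
    moreover have "card (f ` R) = card R"
      using f R(1) by (auto simp: embedding_def intro: card_image inj_on_subset)
    ultimately show ?thesis by (metis length_map order_refl)
  qed
  moreover have "\<exists>f. embedding F G f"
    if "broom_copy G ws L" "length ws = length us" "card R \<le> card L" for ws L
    using is_broom_embedding[OF F(2) R(2) G that] by blast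
  ultimately show ?thesis unfolding containing_iff_embedding[OF F(1) G] by blast
qed

section \<open>Satisfaction and exchange of twins\<close>

lemma sat_cong: "(\<And>x. x \<in> free_vars p \<Longrightarrow> e x = e' x) \<Longrightarrow> sat G e p \<longleftrightarrow> sat G e' p"
proof (induction p arbitrary: e e')
  case (Exi x p)
  have "sat G (e(x := a)) p \<longleftrightarrow> sat G (e'(x := a)) p" for a
    by (rule Exi.IH) (use Exi.prems in auto)
  then show ?case by simp
next
  case (All x p)
  have "sat G (e(x := a)) p \<longleftrightarrow> sat G (e'(x := a)) p" for a
    by (rule All.IH) (use All.prems in auto)
  then show ?case by simp
next
  case (Conj p q)
  then show ?case by (metis UnCI free_vars.simps(4) sat.simps(4))
next
  case (Disj p q)
  then show ?case by (metis UnCI free_vars.simps(5) sat.simps(5))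
next
  case (Neg p)
  then show ?case by (metis free_vars.simps(3) sat.simps(3))
qed auto

lemma sat_sentence: "sentence p \<Longrightarrow> sat G e p \<longleftrightarrow> sat G e' p"
  by (rule sat_cong) (simp add: sentence_def)

lemma models_sentence_iff:
  assumes "sentence p" "pverts G \<noteq> {}"
  shows "models G p \<longleftrightarrow> sat G e p"
proof -
  obtain c where "c \<in> pverts G" using assms(2) by blast
  then have "range (\<lambda>_ :: nat. c) \<subseteq> pverts G" by auto
  then show ?thesis unfolding models_def using sat_sentence[OF assms(1)] by blast
qed

lemma finite_all_vars: "finite (all_vars p)"
  by (induction p) auto

lemma width_pos: "0 < width p"
proof -
  have "all_vars p \<noteq> {}" by (induction p) auto
  then show ?thesis using finite_all_vars by (simp add: width_def card_gt_0_iff)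
qed

lemma sat_back_and_forth:
  assumes "R e e'" "all_vars p \<subseteq> X"
    and atoms: "\<And>e e' x y. R e e' \<Longrightarrow> x \<in> X \<Longrightarrow> y \<in> X \<Longrightarrow>
      (e x = e y \<longleftrightarrow> e' x = e' y) \<and> ((e x, e y) \<in> parcs G \<longleftrightarrow> (e' x, e' y) \<in> parcs H)"
    and zig: "\<And>e e' x a. R e e' \<Longrightarrow> x \<in> X \<Longrightarrow> a \<in> pverts G \<Longrightarrow>
      \<exists>b\<in>pverts H. R (e(x := a)) (e'(x := b))"
    and zag: "\<And>e e' x b. R e e' \<Longrightarrow> x \<in> X \<Longrightarrow> b \<in> pverts H \<Longrightarrow>
      \<exists>a\<in>pverts G. R (e(x := a)) (e'(x := b))"
  shows "sat G e p \<longleftrightarrow> sat H e' p"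
  using assms(1,2)
proof (induction p arbitrary: e e')
  case (Exi x p)
  then have x: "x \<in> X" "all_vars p \<subseteq> X" by auto
  show ?case using zig[OF Exi.prems(1) x(1)] zag[OF Exi.prems(1) x(1)] Exi.IH x(2)
    by simp meson
next
  case (All x p)
  then have x: "x \<in> X" "all_vars p \<subseteq> X" by auto
  show ?case using zig[OF All.prems(1) x(1)] zag[OF All.prems(1) x(1)] All.IH x(2)
    by simp meson
next
  case (Conj p q)
  then have "sat G e p \<longleftrightarrow> sat H e' p" "sat G e q \<longleftrightarrow> sat H e' q" by simp_all
  then show ?case by simp
next
  case (Disj p q)
  then have "sat G e p \<longleftrightarrow> sat H e' p" "sat G e q \<longleftrightarrow> sat H e' q" by simp_all
  then show ?case by simp
qed (use atoms in auto)

locale twin_exchange =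
  fixes G H :: ngraph and C B B' :: "nat set" and k :: nat
  assumes pair_graph_G: "pair_graph G" and pair_graph_H: "pair_graph H"
    and verts_G: "pverts G = C \<union> B" and verts_H: "pverts H = C \<union> B'"
    and disjoint: "C \<inter> B = {}" "C \<inter> B' = {}"
    and large: "k \<le> card B" "k \<le> card B'"
    and arcs_core: "\<And>x y. x \<in> C \<Longrightarrow> y \<in> C \<Longrightarrow> (x, y) \<in> parcs G \<longleftrightarrow> (x, y) \<in> parcs H"
    and arcs_mixed: "\<And>x b b'. x \<in> C \<Longrightarrow> b \<in> B \<Longrightarrow> b' \<in> B' \<Longrightarrow>
      (x, b) \<in> parcs G \<longleftrightarrow> (x, b') \<in> parcs H"
    and arcs_twins: "\<And>b c b' c'. b \<in> B \<Longrightarrow> c \<in> B \<Longrightarrow> b' \<in> B' \<Longrightarrow> c' \<in> B' \<Longrightarrow>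
      b \<noteq> c \<Longrightarrow> b' \<noteq> c' \<Longrightarrow> (b, c) \<in> parcs G \<longleftrightarrow> (b', c') \<in> parcs H"
begin

definition matched :: "nat set \<Rightarrow> (nat \<Rightarrow> nat) \<Rightarrow> (nat \<Rightarrow> nat) \<Rightarrow> bool" where
  "matched X e e' \<longleftrightarrow>
     (\<forall>x\<in>X. e x \<in> C \<and> e' x = e x \<or> e x \<in> B \<and> e' x \<in> B') \<and>
     (\<forall>x\<in>X. \<forall>y\<in>X. e x = e y \<longleftrightarrow> e' x = e' y)"

lemma matched_arcs:
  assumes matched: "matched X e e'" and "x \<in> X" "y \<in> X"
  shows "(e x, e y) \<in> parcs G \<longleftrightarrow> (e' x, e' y) \<in> parcs H"
proof (cases "e x = e y")
  case True
  then have "e' x = e' y" using assms unfolding matched_def by metis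
  then show ?thesis
    using True pair_graph_arcD(3)[OF pair_graph_G] pair_graph_arcD(3)[OF pair_graph_H] by metis
next
  case False
  then have "e' x \<noteq> e' y" using assms unfolding matched_def by blast
  have arcs_mixed': "(b, z) \<in> parcs G \<longleftrightarrow> (b', z) \<in> parcs H" if "z \<in> C" "b \<in> B" "b' \<in> B'" for z b b'
    using arcs_mixed[OF that] pair_graph_arcD(4)[OF pair_graph_G] pair_graph_arcD(4)[OF pair_graph_H]
    by blast
  have "e x \<in> C \<and> e' x = e x \<or> e x \<in> B \<and> e' x \<in> B'" "e y \<in> C \<and> e' y = e y \<or> e y \<in> B \<and> e' y \<in> B'"
    using assms unfolding matched_def by blast+
  then show ?thesis
    using False \<open>e' x \<noteq> e' y\<close>
    by (elim disjE conjE) (simp_all add: arcs_core arcs_mixed arcs_mixed' arcs_twins)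
qed

lemma matched_forth:
  assumes matched: "matched X e e'" and X: "finite X" "card X \<le> k" "x \<in> X" and a: "a \<in> pverts G"
  shows "\<exists>b\<in>pverts H. matched X (e(x := a)) (e'(x := b))"
proof -
  consider (core) "a \<in> C" | (old_twin) y where "y \<in> X - {x}" "a = e y" "a \<in> B"
    | (new_twin) "a \<in> B" "a \<notin> e ` (X - {x})"
    using a verts_G by auto
  then show ?thesis
  proof cases
    case core
    then have "matched X (e(x := a)) (e'(x := a))"
      using matched disjoint unfolding matched_def by (auto; metis disjoint_iff)
    then show ?thesis using core verts_H by blast
  next
    case old_twin
    then have "matched X (e(x := a)) (e'(x := e' y))" "e' y \<in> pverts H"
      using matched verts_H unfolding matched_def by (auto simp: verts_H)
    then show ?thesis by blast
  next
    case new_twin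
    have "card (e' ` (X - {x})) \<le> card (X - {x})" by (rule card_image_le) (use X in simp)
    also have "\<dots> < card X" using X(1,3) by (rule card_Diff1_less)
    also have "\<dots> \<le> card B'" using X(2) large(2) by simp
    finally have "\<not> B' \<subseteq> e' ` (X - {x})" using X(1) card_mono[of "e' ` (X - {x})" B'] by auto
    then obtain b where b: "b \<in> B'" "b \<notin> e' ` (X - {x})" by blast
    have "matched X (e(x := a)) (e'(x := b))"
      using matched new_twin b disjoint unfolding matched_def by (auto; fastforce)
    then show ?thesis using b verts_H by blast
  qed
qed

end

lemma twin_exchange_commute:
  assumes "twin_exchange G H C B B' k"
  shows "twin_exchange H G C B' B k"
  using assms unfolding twin_exchange_def by (elim conjE, intro conjI allI impI) simp_all

lemma (in twin_exchange) models_iff: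
  assumes "sentence p" "width p \<le> k" "C \<noteq> {}"
  shows "models G p \<longleftrightarrow> models H p"
proof -
  interpret swap: twin_exchange H G C B' B k
    by (rule twin_exchange_commute) (rule twin_exchange_axioms)
  have commute: "swap.matched X e' e \<longleftrightarrow> matched X e e'" for X e e'
    unfolding matched_def swap.matched_def by (intro conj_cong ball_cong refl) auto
  obtain c where c: "c \<in> C" using assms(3) by blast
  define X where "X = all_vars p"
  have X: "finite X" "card X \<le> k" using assms(2) finite_all_vars by (auto simp: X_def width_def)
  have "sat G (\<lambda>_. c) p \<longleftrightarrow> sat H (\<lambda>_. c) p"
  proof (rule sat_back_and_forth[where R = "matched X" and X = X])
    fix e e' x y assume matched: "matched X e e'" and "x \<in> X" "y \<in> X"
    then show "(e x = e y \<longleftrightarrow> e' x = e' y) \<and> ((e x, e y) \<in> parcs G \<longleftrightarrow> (e' x, e' y) \<in> parcs H)"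
      using matched_arcs[OF matched] by (simp add: matched_def)
  qed (use c X matched_forth swap.matched_forth[unfolded commute] in \<open>auto simp: matched_def X_def\<close>)
  moreover have "pverts G \<noteq> {}" "pverts H \<noteq> {}" using c verts_G verts_H by auto
  ultimately show ?thesis using models_sentence_iff[OF assms(1)] by blast
qed

section \<open>Pendant paths and broom ends\<close>

definition pendant_path :: "'a pair_pre_digraph \<Rightarrow> 'a list \<Rightarrow> bool" where
  "pendant_path F ys \<longleftrightarrow>
     vpath ys (with_proj F) \<and> parcs F \<inter> set (tl ys) \<times> UNIV \<subseteq> broom_arcs ys {}"

definition broom_end :: "'a pair_pre_digraph \<Rightarrow> 'a list \<Rightarrow> 'a set \<Rightarrow> bool" where
  "broom_end F zs Z \<longleftrightarrow>
     broom_copy F zs Z \<and> parcs F \<inter> (set (butlast zs) \<union> Z) \<times> UNIV \<subseteq> broom_arcs zs Z"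

lemma pendant_path_nbrs:
  assumes "pendant_path F ys" "y \<in> set (tl ys)"
  obtains i where "Suc i < length ys" "y = ys ! Suc i"
    "\<And>v. (y, v) \<in> parcs F \<Longrightarrow> v = ys ! i \<or> Suc (Suc i) < length ys \<and> v = ys ! Suc (Suc i)"
proof -
  obtain i where "i < length (tl ys)" "y = tl ys ! i" using assms(2) by (metis in_set_conv_nth)
  then have i: "Suc i < length ys" "y = ys ! Suc i" by (auto simp: nth_tl)
  have "v = ys ! i \<or> Suc (Suc i) < length ys \<and> v = ys ! Suc (Suc i)" if "(y, v) \<in> parcs F" for v
    using assms that i nth_broom_arcs_iff[of ys "Suc i" v]
    by (auto simp: pendant_path_def vpath_def)
  then show ?thesis using that i by blast
qed

lemma pendant_path_card_nbrs:
  assumes "pendant_path F ys" "y \<in> set (tl ys)"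
  shows "card (nbrs F y) \<le> 2"
proof -
  obtain i where "nbrs F y \<subseteq> {ys ! i, ys ! Suc (Suc i)}"
    by (rule pendant_path_nbrs[OF assms]) auto
  then have "card (nbrs F y) \<le> card {ys ! i, ys ! Suc (Suc i)}" by (intro card_mono) auto
  also have "\<dots> \<le> 2" by (simp add: card_insert_if)
  finally show ?thesis .
qed

lemma pendant_path_Cons:
  assumes F: "pair_graph F" and ys: "pendant_path F ys" "2 \<le> length ys"
    and x: "(x, hd ys) \<in> parcs F" "x \<notin> set ys" and hd: "nbrs F (hd ys) \<subseteq> {x, ys ! 1}"
  shows "pendant_path F (x # ys)"
proof -
  have ne: "ys \<noteq> []" using ys(2) by auto
  have "(y, v) \<in> broom_arcs (x # ys) {}" if "y \<in> set ys" "(y, v) \<in> parcs F" for y v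
  proof (cases "y \<in> set (tl ys)")
    case True
    then have "(y, v) \<in> broom_arcs ys {}" using ys(1) that(2) by (auto simp: pendant_path_def)
    then show ?thesis using ne by (auto simp: broom_arcs_def)
  next
    case False
    then have "y = hd ys" using that(1) ne by (metis hd_Cons_tl set_ConsD)
    moreover have "(hd ys, ys ! 1) \<in> set (vwalk_arcs ys)"
      using ys(2) ne vwalk_arcs_nthI[of 0 ys] by (simp add: hd_conv_nth)
    ultimately show ?thesis using hd that(2) ne by (auto simp: broom_arcs_def)
  qed
  moreover have "vpath (x # ys) (with_proj F)"
    using ys(1) x pair_graph_arcD(1)[OF F x(1)] ne
    by (auto simp: pendant_path_def vpath_iff_successively successively_Cons)
  ultimately show ?thesis by (auto simp: pendant_path_def)
qed

lemma ex_maximal_pendant_path: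
  assumes F: "pair_graph F" and xs: "pendant_path F xs"
  obtains ys where "pendant_path F ys" "\<And>zs. pendant_path F zs \<Longrightarrow> length zs \<le> length ys"
proof -
  have "length zs < Suc (card (pverts F))" if "pendant_path F zs" for zs
    using that card_mono[OF pair_graph_finite(1)[OF F], of "set zs"]
    by (auto simp: pendant_path_def vpath_iff_successively distinct_card less_Suc_eq_le)
  then show ?thesis
    using that ex_has_greatest_nat[of "pendant_path F" xs length "Suc (card (pverts F))"] xs
    by blast
qed

lemma pendant_path_disjoint_leaves:
  assumes F: "pair_graph F" and ys: "pendant_path F ys" "3 \<le> length ys"
    and L: "\<And>l. l \<in> L \<Longrightarrow> nbrs F l = {c}" "3 \<le> card L"
  shows "L \<inter> set (tl ys) = {}"
proof (rule ccontr)
  assume "L \<inter> set (tl ys) \<noteq> {}"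
  then obtain l where l: "l \<in> L" "l \<in> set (tl ys)" by blast
  have arcs: "set (vwalk_arcs ys) \<subseteq> parcs F" and dist: "distinct ys"
    using ys(1) by (auto simp: pendant_path_def vpath_def vwalk_def)
  have "c \<notin> set (tl ys)"
  proof
    assume "c \<in> set (tl ys)"
    moreover have "(c, l) \<in> parcs F" if "l \<in> L" for l
      using L(1)[OF that] pair_graph_arcD(4)[OF F] by blast
    then have "card L \<le> card (nbrs F c)" by (intro card_mono pair_graph_finite(2)[OF F]) auto
    ultimately show False using pendant_path_card_nbrs[OF ys(1), of c] L(2) by simp
  qed
  obtain i where i: "Suc i < length ys" "l = ys ! Suc i" by (rule pendant_path_nbrs[OF ys(1) l(2)])
  then have "(l, ys ! i) \<in> parcs F" using arcs vwalk_arcs_nthI pair_graph_arcD(4)[OF F] by blast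
  then have c: "c = ys ! i" using L(1)[OF l(1)] by auto
  have "i = 0"
  proof (rule ccontr)
    assume "i \<noteq> 0"
    then have "c \<in> set (tl ys)" using c i(1) nth_mem[of "i - 1" "tl ys"] by (simp add: nth_tl)
    then show False using \<open>c \<notin> set (tl ys)\<close> by simp
  qed
  then have "(l, ys ! 2) \<in> parcs F"
    using arcs vwalk_arcs_nthI[of 1 ys] ys(2) i(2) by (auto simp: numeral_2_eq_2)
  then have "ys ! 2 = ys ! 0" using c \<open>i = 0\<close> L(1)[OF l(1)] by auto
  then show False using dist ys(2) nth_eq_iff_index_eq[of ys 2 0] by (cases ys) auto
qed

lemma broom_end_hd_nbrs:
  assumes F: "pair_graph F" and Z: "broom_end F zs Z" "2 \<le> card Z" and "2 \<le> length zs"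
  shows "3 \<le> card (nbrs F (hd zs))"
proof -
  have Z': "Z \<subseteq> nbrs F (hd zs)" "Z \<inter> set zs = {}" and arcs: "set (vwalk_arcs zs) \<subseteq> parcs F"
    using Z(1) by (auto simp: broom_end_def broom_copy_def vpath_def vwalk_def)
  have ne: "zs \<noteq> []" using assms(4) by auto
  have "(hd zs, zs ! 1) \<in> set (vwalk_arcs zs)"
    using assms(4) ne vwalk_arcs_nthI[of 0 zs] by (simp add: hd_conv_nth)
  then have sub: "insert (zs ! 1) Z \<subseteq> nbrs F (hd zs)" using arcs Z'(1) by auto
  have "zs ! 1 \<notin> Z" using Z'(2) assms(4) nth_mem[of 1 zs] by auto
  moreover have "finite Z" using Z(2) card.infinite by fastforce
  ultimately have "3 \<le> card (insert (zs ! 1) Z)" using Z(2) by simp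
  then show ?thesis using card_mono[OF pair_graph_finite(2)[OF F] sub] by simp
qed

lemma broom_end_card_nbrs:
  assumes F: "pair_graph F" and Z: "broom_end F zs Z" "2 \<le> card Z" and z: "z \<in> set (butlast zs)"
  shows "2 \<le> card (nbrs F z)"
proof -
  obtain j where "j < length (butlast zs)" "z = butlast zs ! j" using z by (metis in_set_conv_nth)
  then have j: "Suc j < length zs" "z = zs ! j" by (auto simp: nth_butlast)
  have arcs: "set (vwalk_arcs zs) \<subseteq> parcs F" and dist: "distinct zs"
    using Z(1) by (auto simp: broom_end_def broom_copy_def vpath_def vwalk_def)
  show ?thesis
  proof (cases j)
    case 0
    then have "z = hd zs" using j by (cases zs) auto
    then show ?thesis using broom_end_hd_nbrs[OF F Z] j by simp
  next
    case (Suc i)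
    then have "{zs ! i, zs ! Suc j} \<subseteq> nbrs F z"
      using arcs vwalk_arcs_nthI[of i zs] vwalk_arcs_nthI[of j zs] j pair_graph_arcD(4)[OF F]
      by auto
    then have "card {zs ! i, zs ! Suc j} \<le> card (nbrs F z)"
      by (rule card_mono[OF pair_graph_finite(2)[OF F]])
    moreover have "zs ! i \<noteq> zs ! Suc j" using dist j Suc by (simp add: nth_eq_iff_index_eq)
    ultimately show ?thesis by simp
  qed
qed

lemma broom_end_enters_pendant_path:
  assumes F: "pair_graph F" and ys: "pendant_path F ys" and zs: "broom_end F zs Z" "2 \<le> card Z"
    and meet: "set (tl ys) \<inter> set (butlast zs) \<noteq> {}"
  obtains j where "Suc (Suc j) < length zs" "zs ! j = hd ys" "zs ! Suc j = ys ! 1"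
    "\<And>i. i \<le> j \<Longrightarrow> zs ! i \<notin> set (tl ys)"
proof -
  have arcs: "set (vwalk_arcs zs) \<subseteq> parcs F"
    using zs(1) by (auto simp: broom_end_def broom_copy_def vpath_def vwalk_def)
  let ?meets = "\<lambda>j. Suc j < length zs \<and> zs ! j \<in> set (tl ys)"
  obtain b where b: "b \<in> set (tl ys)" "b \<in> set (butlast zs)" using meet by blast
  then obtain j where "j < length (butlast zs)" "butlast zs ! j = b" by (meson in_set_conv_nth)
  then have "?meets j" using b(1) by (auto simp: nth_butlast)
  then obtain j where j: "?meets j" and first: "\<And>i. i < j \<Longrightarrow> \<not> ?meets i"
    using exists_least_iff[of ?meets] by blast
  have "hd zs \<notin> set (tl ys)"
    using broom_end_hd_nbrs[OF F zs] pendant_path_card_nbrs[OF ys, of "hd zs"] j by fastforce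
  then obtain i where i: "j = Suc i" using j by (cases j; cases zs) auto
  have outside: "zs ! i' \<notin> set (tl ys)" if "i' \<le> i" for i' using first[of i'] j i that by auto
  have "(zs ! j, zs ! i) \<in> parcs F"
    using arcs vwalk_arcs_nthI[of i zs] j i pair_graph_arcD(4)[OF F] by auto
  moreover have "zs ! j \<in> set (tl ys)" using j by blast
  ultimately obtain r where r: "Suc r < length ys" "zs ! j = ys ! Suc r"
    "zs ! i = ys ! r \<or> Suc (Suc r) < length ys \<and> zs ! i = ys ! Suc (Suc r)"
    using pendant_path_nbrs[OF ys, of "zs ! j"] by metis
  have "ys ! Suc s \<in> set (tl ys)" if "Suc s < length ys" for s
    using that nth_mem[of s "tl ys"] by (simp add: nth_tl)
  then have "r = 0 \<and> zs ! i = ys ! 0"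
    using r outside[of i] by (cases r) auto
  then show ?thesis
    using that[of i] r j i outside by (cases ys) auto
qed

lemma broom_end_meets_maximal_pendant_path:
  assumes F: "pair_graph F"
    and ys: "pendant_path F ys" "\<And>xs. pendant_path F xs \<Longrightarrow> length xs \<le> length ys"
    and zs: "broom_end F zs Z" "2 \<le> card Z" and meet: "set (tl ys) \<inter> set (butlast zs) \<noteq> {}"
  shows "hd zs = hd ys \<and> zs ! 1 \<in> set ys"
proof -
  have dist: "distinct zs" and arcs: "set (vwalk_arcs zs) \<subseteq> parcs F" and Z: "Z \<inter> set zs = {}"
    using zs(1) by (auto simp: broom_end_def broom_copy_def vpath_def vwalk_def)
  have len: "2 \<le> length ys" using meet by (cases ys rule: remdups_adj.cases) auto
  obtain j where j: "Suc (Suc j) < length zs" "zs ! j = hd ys" "zs ! Suc j = ys ! 1"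
    "\<And>i. i \<le> j \<Longrightarrow> zs ! i \<notin> set (tl ys)"
    by (rule broom_end_enters_pendant_path[OF F ys(1) zs meet]) blast
  show ?thesis
  proof (cases j)
    case 0
    then show ?thesis using j len nth_mem[of 1 ys] by (cases zs) auto
  next
    case (Suc i)
    have "(zs ! i, hd ys) \<in> parcs F" using arcs vwalk_arcs_nthI[of i zs] j Suc by auto
    moreover have "zs ! i \<notin> set ys"
    proof -
      have "zs ! i \<noteq> hd ys" using dist j(1,2) Suc nth_eq_iff_index_eq[of zs i j] by auto
      then show ?thesis using j(4)[of i] Suc by (cases ys) auto
    qed
    moreover have "nbrs F (hd ys) \<subseteq> {zs ! i, ys ! 1}"
    proof
      fix v assume "v \<in> nbrs F (hd ys)"
      moreover have "zs ! j \<in> set (butlast zs)"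
        using j(1) nth_mem[of j "butlast zs"] by (simp add: nth_butlast)
      ultimately have "(zs ! j, v) \<in> broom_arcs zs Z" using zs(1) j(2) by (auto simp: broom_end_def)
      moreover have "zs ! j \<noteq> hd zs" "zs ! j \<notin> Z"
        using dist Z j(1) Suc nth_mem[of j zs] by (cases zs; auto)+
      ultimately have "(zs ! j, v) \<in> broom_arcs zs {}" by (auto simp: broom_arcs_def)
      then show "v \<in> {zs ! i, ys ! 1}" using dist j(1,3) Suc by (auto simp: nth_broom_arcs_iff)
    qed
    ultimately have "length (zs ! i # ys) \<le> length ys"
      by (intro ys(2) pendant_path_Cons[OF F ys(1) len])
    then show ?thesis by simp
  qed
qed

lemma pendant_path_tl_nbrs:
  assumes "pendant_path F ys" "u \<in> set (tl ys)" "(u, v) \<in> parcs F"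
  shows "v \<in> set ys"
proof -
  have "(u, v) \<in> broom_arcs ys {}" using assms by (auto simp: pendant_path_def)
  then show ?thesis by (auto simp: broom_arcs_def dest: arcs_in_vwalk_arcs)
qed

lemma broom_end_leaf_nbrs:
  assumes zs: "broom_end F zs Z" and "l \<in> Z" "(l, v) \<in> parcs F"
  shows "v = hd zs"
proof -
  have "(l, v) \<in> broom_arcs zs Z" "l \<notin> set zs" "zs \<noteq> []"
    using assms by (auto simp: broom_end_def broom_copy_def vpath_iff_successively)
  then show ?thesis using hd_in_set[of zs] by (auto simp: broom_arcs_def dest: arcs_in_vwalk_arcs)
qed

lemma broom_end_centre_nbrs:
  assumes zs: "broom_end F zs Z" "2 \<le> length zs" and v: "(hd zs, v) \<in> parcs F"
  shows "v = zs ! 1 \<or> v \<in> Z"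
proof -
  have zs': "distinct zs" "zs \<noteq> []" "Z \<inter> set zs = {}"
    using zs(1) by (auto simp: broom_end_def broom_copy_def vpath_iff_successively)
  have "hd zs \<in> set (butlast zs)" "hd zs = zs ! 0" using zs(2) by (cases zs; auto)+
  then have "(zs ! 0, v) \<in> broom_arcs zs {} \<or> v \<in> Z"
    using zs(1) v zs'(3) nth_mem[of 0 zs] zs'(2) by (auto simp: broom_end_def broom_arcs_def)
  then show ?thesis using zs' by (auto simp: nth_broom_arcs_iff)
qed

lemma pverts_subset_if_broom_end_meets_pendant_path:
  assumes conn: "connected_graph F"
    and ys: "pendant_path F ys" "\<And>xs. pendant_path F xs \<Longrightarrow> length xs \<le> length ys"
    and zs: "broom_end F zs Z" "2 \<le> card Z" and meet: "set (tl ys) \<inter> set (butlast zs) \<noteq> {}"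
  shows "pverts F \<subseteq> set ys \<union> Z"
proof (rule connected_graph_closed[OF conn])
  have hd: "hd zs = hd ys" "zs ! 1 \<in> set ys"
    using broom_end_meets_maximal_pendant_path[OF connected_graph_pair_graph[OF conn] ys zs meet]
    by auto
  have path: "ys \<noteq> []" "set ys \<subseteq> pverts F"
    using ys(1) by (auto simp: pendant_path_def vpath_iff_successively)
  have len: "2 \<le> length zs" using meet by (cases zs rule: remdups_adj.cases) auto
  show "(set ys \<union> Z) \<inter> pverts F \<noteq> {}" using path by (cases ys) auto
  fix u v assume u: "u \<in> set ys \<union> Z" and uv: "(u, v) \<in> parcs F"
  consider "u \<in> set (tl ys)" | "u = hd ys" | "u \<in> Z" using u path(1) by (cases ys) auto
  then show "v \<in> set ys \<union> Z"
  proof cases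
    case 1
    then show ?thesis using pendant_path_tl_nbrs[OF ys(1) _ uv] by blast
  next
    case 2
    then show ?thesis using broom_end_centre_nbrs[OF zs(1) len] uv hd by auto
  next
    case 3
    then show ?thesis using broom_end_leaf_nbrs[OF zs(1) _ uv] hd(1) path(1) by simp
  qed
qed

lemma is_broom_if_broom_end_meets_pendant_path:
  assumes conn: "connected_graph F"
    and ys: "pendant_path F ys" "\<And>xs. pendant_path F xs \<Longrightarrow> length xs \<le> length ys"
    and zs: "broom_end F zs Z" "2 \<le> card Z" and meet: "set (tl ys) \<inter> set (butlast zs) \<noteq> {}"
  shows "is_broom F ys (pverts F - set ys)"
proof -
  have F: "pair_graph F" using conn by (rule connected_graph_pair_graph)
  have hd: "hd zs = hd ys" using broom_end_meets_maximal_pendant_path[OF F ys zs meet] by simp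
  have path: "vpath ys (with_proj F)" "ys \<noteq> []" "set ys \<subseteq> pverts F"
    and tl: "parcs F \<inter> set (tl ys) \<times> UNIV \<subseteq> broom_arcs ys {}"
    using ys(1) by (auto simp: pendant_path_def vpath_iff_successively)
  have off_path: "u \<in> Z" if "u \<in> pverts F - set ys" for u
    using pverts_subset_if_broom_end_meets_pendant_path[OF conn ys zs meet] that by blast
  moreover have "Z \<subseteq> nbrs F (hd ys)" using zs(1) hd by (auto simp: broom_copy_def broom_end_def)
  ultimately have "broom_copy F ys (pverts F - set ys)"
    using path(1) by (auto simp: broom_copy_def)
  moreover have "(u, v) \<in> broom_arcs ys (pverts F - set ys)" if uv: "(u, v) \<in> parcs F" for u v
  proof -
    have verts: "u \<in> pverts F" "v \<in> pverts F" "u \<noteq> v" "(v, u) \<in> parcs F"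
      using pair_graph_arcD[OF F uv] by auto
    consider "u \<in> set (tl ys)" | "v \<in> set (tl ys)" | "u \<notin> set ys" | "v \<notin> set ys"
      | "u = hd ys" "v = hd ys"
      using path(2) by (cases ys) auto
    then show ?thesis
    proof cases
      case 1 then show ?thesis using uv tl by (auto simp: broom_arcs_def)
    next
      case 2 then show ?thesis using verts(4) tl by (auto simp: broom_arcs_def)
    next
      case 3 then show ?thesis
        using broom_end_leaf_nbrs[OF zs(1) off_path uv] verts hd by (auto simp: broom_arcs_def)
    next
      case 4 then show ?thesis
        using broom_end_leaf_nbrs[OF zs(1) off_path verts(4)] verts hd
        by (auto simp: broom_arcs_def)
    qed (use verts in simp)
  qed
  ultimately show ?thesis using path(3) by (auto simp: is_broom_def)
qed

section \<open>Cliques with an attached path and star\<close>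

text \<open>
  A path \<open>0, \<dots>, t\<close>, then \<open>N\<close> leaves at \<open>t\<close>, then \<open>k\<close> vertices that form a clique together with \<open>0\<close>.
\<close>

definition lollipop_adj :: "nat \<Rightarrow> nat \<Rightarrow> nat \<Rightarrow> nat \<Rightarrow> bool" where
  "lollipop_adj t N i j \<longleftrightarrow>
     j = Suc i \<and> j \<le> t \<or> i = t \<and> t < j \<and> j \<le> t + N \<or> (i = 0 \<or> t + N < i) \<and> t + N < j"

definition leafy_lollipop :: "nat \<Rightarrow> nat \<Rightarrow> nat \<Rightarrow> ngraph" where
  "leafy_lollipop t N k = mk_graph (t + 1 + N + k) (lollipop_adj t N)"

lemma connected_leafy_lollipop: "connected_graph (leafy_lollipop t N k)"
  unfolding leafy_lollipop_def
proof (rule connected_mk_graph)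
  fix i :: nat assume "0 < i"
  then show "\<exists>j<i. lollipop_adj t N i j \<or> lollipop_adj t N j i"
    by (intro exI[of _ "if i \<le> t then i - 1 else if i \<le> t + N then t else 0"])
      (auto simp: lollipop_adj_def)
qed simp

lemma pair_graph_leafy_lollipop: "pair_graph (leafy_lollipop t N k)"
  by (simp add: leafy_lollipop_def)

lemma twin_exchange_leafy_lollipop:
  assumes "m \<le> k" "m \<le> k'"
  shows "twin_exchange (leafy_lollipop t N k) (leafy_lollipop t N k')
    {..t + N} {t + N<..<t + 1 + N + k} {t + N<..<t + 1 + N + k'} m"
  using assms by (intro twin_exchange.intro) (auto simp: leafy_lollipop_def lollipop_adj_def)

lemma embedding_leafy_lollipop:
  assumes "pair_graph F"
  obtains f where "embedding F (leafy_lollipop t N (k + v_count F)) f"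
proof -
  obtain h where h: "bij_betw h (pverts F) {..<v_count F}"
    using ex_bij_betw_finite_nat[OF pair_graph_finite(1)[OF assms]]
    by (auto simp: lessThan_atLeast0)
  have h_less: "h v < v_count F" if "v \<in> pverts F" for v using h that by (auto simp: bij_betw_def)
  have "embedding F (leafy_lollipop t N (k + v_count F)) (\<lambda>v. t + 1 + N + h v)"
    unfolding embedding_def
  proof (intro conjI ballI)
    show "inj_on (\<lambda>v. t + 1 + N + h v) (pverts F)" using h by (auto simp: bij_betw_def inj_on_def)
    fix a assume "a \<in> parcs F"
    then obtain u v where a: "a = (u, v)" "u \<in> pverts F" "v \<in> pverts F" "u \<noteq> v"
      using pair_graph_arcD[OF assms] by (cases a) metis
    then have "h u \<noteq> h v" using h by (auto simp: bij_betw_def inj_on_def)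
    then show "case a of (u, v) \<Rightarrow>
        (t + 1 + N + h u, t + 1 + N + h v) \<in> parcs (leafy_lollipop t N (k + v_count F))"
      using a h_less by (auto simp: leafy_lollipop_def lollipop_adj_def trans_less_add2)
  qed (use h_less in \<open>auto simp: leafy_lollipop_def lollipop_adj_def trans_less_add2\<close>)
  then show ?thesis by (rule that)
qed

locale lollipop_embedding =
  fixes F :: ngraph and f :: "nat \<Rightarrow> nat" and t N k :: nat
  assumes connected: "connected_graph F" and embedding_f: "embedding F (leafy_lollipop t N k) f"
begin

lemma pair_graph_F: "pair_graph F"
  using connected by (rule connected_graph_pair_graph)

lemma f_eq_iff: "u \<in> pverts F \<Longrightarrow> v \<in> pverts F \<Longrightarrow> f u = f v \<longleftrightarrow> u = v"
  using embedding_f by (auto simp: embedding_def inj_on_eq_iff)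

definition outer :: "nat \<Rightarrow> nat set" where
  "outer i = {v\<in>pverts F. i \<le> f v \<and> f v \<le> t + N}"

lemma outer_sub: "outer i \<subseteq> pverts F"
  by (auto simp: outer_def)

lemma arc_cases:
  assumes "(u, v) \<in> parcs F"
  obtains (path) "f v = Suc (f u)" "f v \<le> t" | (path') "f u = Suc (f v)" "f u \<le> t"
  | (leaf) "f u = t" "t < f v" "f v \<le> t + N" | (leaf') "f v = t" "t < f u" "f u \<le> t + N"
  | (clique) "f u = 0 \<or> t + N < f u" "f v = 0 \<or> t + N < f v"
  using embedding_arc[OF embedding_f assms] by (auto simp: leafy_lollipop_def lollipop_adj_def)

lemma v_count_le_card_outer: "v_count F \<le> card (outer 1) + k + 1"
proof -
  have "card (pverts F - outer 1) \<le> card (insert 0 {t + N<..<t + 1 + N + k})"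
  proof (rule card_inj_on_le[of f])
    show "inj_on f (pverts F - outer 1)"
      using embedding_f by (auto simp: embedding_def intro: inj_on_subset)
    show "f ` (pverts F - outer 1) \<subseteq> insert 0 {t + N<..<t + 1 + N + k}"
      using embedding_f by (fastforce simp: embedding_def outer_def leafy_lollipop_def)
  qed simp
  then show ?thesis
    using card_Diff_subset[OF _ outer_sub, of 1]
      finite_subset[OF outer_sub pair_graph_finite(1)[OF pair_graph_F]]
    by simp
qed

lemma cut_arc:
  assumes "i < t" "a \<in> outer (Suc i)" "b \<in> pverts F - outer 1"
  obtains u v where "(u, v) \<in> parcs F" "f u = i" "f v = Suc i"
proof -
  have "a \<in> pverts F" "b \<in> pverts F" "b \<notin> outer (Suc i)"
    using assms(2,3) by (auto simp: outer_def)
  then obtain v u where uv: "(v, u) \<in> parcs F" "v \<in> outer (Suc i)" "u \<notin> outer (Suc i)"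
    using connected_graph_ex_cut_arc[OF connected, of a b "\<lambda>v. v \<in> outer (Suc i)"] assms(2) by blast
  have "u \<in> pverts F" using pair_graph_arcD(2)[OF pair_graph_F uv(1)] .
  have "f u = i \<and> f v = Suc i"
    by (rule arc_cases[OF uv(1)]) (use uv(2,3) \<open>u \<in> pverts F\<close> assms(1) in \<open>auto simp: outer_def\<close>)
  then show ?thesis using that pair_graph_arcD(4)[OF pair_graph_F uv(1)] by blast
qed

definition stem :: "nat list \<Rightarrow> nat \<Rightarrow> bool" where
  "stem us d \<longleftrightarrow> vpath us (with_proj F) \<and> map f us = [0..<Suc d]"

lemma ex_stem:
  assumes d: "1 \<le> d" "d \<le> t" and "a \<in> outer d" "b \<in> pverts F - outer 1"
  obtains us where "stem us d"
proof -
  define g where "g = inv_into (pverts F) f"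
  have arc: "(g i, g (Suc i)) \<in> parcs F \<and> f (g i) = i \<and> f (g (Suc i)) = Suc i" if i: "i < d" for i
  proof -
    have "a \<in> outer (Suc i)" using assms(3) i by (auto simp: outer_def)
    then obtain u v where uv: "(u, v) \<in> parcs F" "f u = i" "f v = Suc i"
      using cut_arc[of i a b] assms(4) d(2) i by auto
    moreover have "g (f x) = x" if "x \<in> pverts F" for x
      using embedding_f that unfolding g_def embedding_def by (intro inv_into_f_f) auto
    ultimately have "g i = u" "g (Suc i) = v"
      using pair_graph_arcD(1,2)[OF pair_graph_F uv(1)] by metis+
    then show ?thesis using uv by simp
  qed
  have fg: "f (g i) = i" "g i \<in> pverts F" if "i \<le> d" for i
  proof -
    show "f (g i) = i" using arc[of i] arc[of "d - 1"] that d(1) by (cases "i = d") auto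
    show "g i \<in> pverts F"
      using arc[of i] arc[of "d - 1"] that d(1) pair_graph_arcD(1,2)[OF pair_graph_F]
      by (cases "i = d") force+
  qed
  have map: "map f (map g [0..<Suc d]) = [0..<Suc d]"
    unfolding map_map using fg by (intro map_idI) auto
  then have "distinct (map g [0..<Suc d])" using distinct_map by (metis distinct_upt)
  moreover have "successively (\<lambda>u v. (u, v) \<in> parcs F) (map g [0..<Suc d])"
    using arc by (auto simp: successively_conv_nth simp del: upt_Suc)
  ultimately have "vpath (map g [0..<Suc d]) (with_proj F)"
    using fg(2) by (auto simp: vpath_iff_successively simp del: upt_Suc)
  then show ?thesis using map that unfolding stem_def by blast
qed

lemma stem_length: "stem us d \<Longrightarrow> length us = Suc d"
  by (metis stem_def length_map length_upt diff_zero)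

lemma stem_subset: "stem us d \<Longrightarrow> set us \<subseteq> pverts F"
  by (simp add: stem_def vpath_iff_successively)

lemma stem_tl:
  assumes "stem us d" "u \<in> set (tl us)"
  shows "1 \<le> f u" "f u \<le> d"
proof -
  have "f u \<in> set (tl (map f us))" using assms(2) by (simp add: map_tl[symmetric])
  then show "1 \<le> f u" "f u \<le> d" using assms(1) by (auto simp: stem_def tl_upt simp del: upt_Suc)
qed

lemma stem_nth:
  assumes us: "stem us d" and v: "v \<in> pverts F" "f v \<le> d"
  shows "us ! f v = v"
proof -
  have len: "f v < length us" using stem_length[OF us] v(2) by simp
  then have "f (us ! f v) = map f us ! f v" by simp
  also have "\<dots> = f v" using us v(2) by (simp add: stem_def del: upt_Suc)
  finally show ?thesis using f_eq_iff len stem_subset[OF us] v(1) nth_mem by blast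
qed

lemma stem_arc:
  assumes us: "stem us d" and "u \<in> pverts F" "v \<in> pverts F" "f v = Suc (f u)" "f v \<le> d"
  shows "(u, v) \<in> set (vwalk_arcs us)"
proof -
  have "us ! f u = u" "us ! Suc (f u) = v" using stem_nth[OF us] assms(2-5) by force+
  then show ?thesis using vwalk_arcs_nthI[of "f u" us] stem_length[OF us] assms(4,5) by simp
qed

lemma star_of_embedding:
  assumes "t = 0" "1 < v_count F"
  obtains c where "\<And>l. l \<in> outer 1 \<Longrightarrow> nbrs F l = {c}"
proof -
  have "nbrs F l = {inv_into (pverts F) f 0}" if l: "l \<in> outer 1" for l
  proof -
    have "v = inv_into (pverts F) f 0" if v: "(l, v) \<in> parcs F" for v
    proof -
      have "f v = 0" by (rule arc_cases[OF v]) (use l[unfolded outer_def] assms(1) in auto)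
      then show ?thesis
        using embedding_f pair_graph_arcD(2)[OF pair_graph_F v]
        by (metis embedding_def inv_into_f_f)
    qed
    moreover have "nbrs F l \<noteq> {}"
      using l outer_sub connected_graph_nbrs_nonempty[OF connected _ assms(2)] by blast
    ultimately show ?thesis by auto
  qed
  then show ?thesis by (rule that)
qed

lemma outer_card_nbrs:
  assumes "N = 0" "c \<in> outer 1"
  shows "card (nbrs F c) \<le> 2"
proof -
  have "f ` nbrs F c \<subseteq> {f c - 1, Suc (f c)}"
  proof
    fix i assume "i \<in> f ` nbrs F c"
    then obtain v where v: "(c, v) \<in> parcs F" "i = f v" by auto
    show "i \<in> {f c - 1, Suc (f c)}"
      by (rule arc_cases[OF v(1)])
        (use v(2) assms(1) assms(2)[unfolded outer_def] in auto)
  qed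
  then have "card (f ` nbrs F c) \<le> card {f c - 1, Suc (f c)}" by (intro card_mono) auto
  also have "\<dots> \<le> 2" by (simp add: card_insert_if)
  also have "card (f ` nbrs F c) = card (nbrs F c)"
    using f_eq_iff pair_graph_arcD(2)[OF pair_graph_F] by (intro card_image inj_onI) auto
  finally show ?thesis .
qed

lemma pendant_path_of_embedding:
  assumes "N = 0" "outer 1 \<noteq> {}" "b \<in> pverts F - outer 1"
  obtains ys where "pendant_path F ys" "card (outer 1) < length ys"
proof -
  have fin: "finite (f ` outer 1)" "f ` outer 1 \<noteq> {}"
    using finite_subset[OF outer_sub pair_graph_finite(1)[OF pair_graph_F]] assms(2) by auto
  define d where "d = Max (f ` outer 1)"
  obtain a where a: "a \<in> outer 1" "f a = d" using Max_in[OF fin] by (auto simp: d_def)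
  have top: "f v \<le> d" if "v \<in> outer 1" for v unfolding d_def using that fin by simp
  have d: "1 \<le> d" "d \<le> t" using a(1)[unfolded outer_def] a(2) assms(1) by auto
  have "a \<in> outer d" using a by (simp add: outer_def)
  obtain us where us: "stem us d"
    by (rule ex_stem[OF d \<open>a \<in> outer d\<close> assms(3)])
  have "card (outer 1) \<le> card {1..d}"
    by (rule card_inj_on_le[of f]) (use top f_eq_iff in \<open>auto simp: outer_def intro: inj_onI\<close>)
  moreover have "(u, v) \<in> broom_arcs us {}"
    if u: "u \<in> set (tl us)" and uv: "(u, v) \<in> parcs F" for u v
  proof -
    have fu: "1 \<le> f u" "f u \<le> d" using stem_tl[OF us u] by auto
    have verts: "u \<in> pverts F" "v \<in> pverts F" using pair_graph_arcD[OF pair_graph_F uv] by auto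
    have "f v = Suc (f u) \<and> f v \<le> t \<or> f u = Suc (f v)"
      by (rule arc_cases[OF uv]) (use fu d(2) assms(1) in auto)
    moreover have "v \<in> outer 1" if "f v = Suc (f u)" "f v \<le> t"
      using that verts by (simp add: outer_def)
    ultimately show ?thesis
      using stem_arc[OF us verts] stem_arc[OF us verts(2,1)] fu top[of v]
      by (auto simp: broom_arcs_def)
  qed
  ultimately show ?thesis
    using that[of us] us stem_length[OF us] by (auto simp: pendant_path_def stem_def)
qed

lemma pendant_path_reaches_clique:
  assumes ys: "pendant_path F ys" "t + 2 < length ys"
  obtains b where "b \<in> pverts F - outer 1"
proof (cases "pverts F \<subseteq> outer 1")
  case True
  have dist: "distinct ys" and arcs: "set (vwalk_arcs ys) \<subseteq> parcs F"
    using ys(1) by (auto simp: pendant_path_def vpath_def vwalk_def)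
  have inner: "y \<in> pverts F \<and> 1 \<le> f y \<and> f y \<le> t" if y: "y \<in> set (butlast (tl ys))" for y
  proof -
    obtain i where "i < length (butlast (tl ys))" "y = butlast (tl ys) ! i"
      using y by (metis in_set_conv_nth)
    then have i: "Suc (Suc i) < length ys" "y = ys ! Suc i" by (auto simp: nth_butlast nth_tl)
    then have uv: "(y, ys ! i) \<in> parcs F" "(y, ys ! Suc (Suc i)) \<in> parcs F"
      using arcs vwalk_arcs_nthI[of i ys] vwalk_arcs_nthI[of "Suc i" ys]
        pair_graph_arcD(4)[OF pair_graph_F] by auto
    have "ys ! i \<noteq> ys ! Suc (Suc i)" using dist i(1) by (simp add: nth_eq_iff_index_eq)
    then have ne: "f (ys ! i) \<noteq> f (ys ! Suc (Suc i))"
      using f_eq_iff pair_graph_arcD(2)[OF pair_graph_F uv(1)]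
        pair_graph_arcD(2)[OF pair_graph_F uv(2)] by simp
    have "y \<in> outer 1" using True pair_graph_arcD(1)[OF pair_graph_F uv(1)] by auto
    moreover have "\<not> t < f y"
    proof
      assume *: "t < f y"
      have "f v = t" if "(y, v) \<in> parcs F" for v
        by (rule arc_cases[OF that]) (use * \<open>y \<in> outer 1\<close> in \<open>auto simp: outer_def\<close>)
      then show False using uv ne by metis
    qed
    ultimately show ?thesis by (auto simp: outer_def)
  qed
  have "card (set (butlast (tl ys))) \<le> card {1..t}"
    by (rule card_inj_on_le[of f]) (use inner f_eq_iff in \<open>auto intro: inj_onI\<close>)
  moreover have "card (set (butlast (tl ys))) = length ys - 2"
    using dist by (simp add: distinct_card distinct_butlast distinct_tl)
  ultimately show ?thesis using ys(2) by simp
qed (use that in auto)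

lemma outer_leaf_nbrs:
  assumes "l \<in> outer (Suc t)" "(l, v) \<in> parcs F"
  shows "f v = t"
  by (rule arc_cases[OF assms(2)]) (use assms(1) in \<open>auto simp: outer_def\<close>)

lemma stem_last:
  assumes us: "stem us t" and "v \<in> pverts F" "f v = t"
  shows "v = last us"
  using stem_nth[OF us assms(2)] stem_length[OF us] assms(3) by (cases us rule: rev_cases) auto

lemma stem_broom_copy:
  assumes us: "stem us t" and "1 < v_count F"
  shows "broom_copy F (rev us) (outer (Suc t))"
proof -
  have "l \<in> nbrs F (last us) - set us" if l: "l \<in> outer (Suc t)" for l
  proof -
    obtain v where v: "(l, v) \<in> parcs F"
      using connected_graph_nbrs_nonempty[OF connected _ assms(2)] l outer_sub by blast
    have "f ` set us = {..t}"
      using us unfolding stem_def by (metis set_map set_upt atLeast0LessThan lessThan_Suc_atMost)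
    then have "f l \<notin> f ` set us" using l by (simp add: outer_def)
    moreover have "v = last us"
      using stem_last[OF us pair_graph_arcD(2)[OF pair_graph_F v]] outer_leaf_nbrs[OF l v] by simp
    ultimately show ?thesis using pair_graph_arcD(4)[OF pair_graph_F v] by auto
  qed
  then show ?thesis
    using vpath_rev[OF pair_graph_F] us by (auto simp: broom_copy_def stem_def hd_rev)
qed

lemma stem_broom_end:
  assumes us: "stem us t" and "1 < v_count F"
  shows "broom_end F (rev us) (outer (Suc t))"
proof -
  have "(u, v) \<in> broom_arcs (rev us) (outer (Suc t))"
    if u: "u \<in> set (butlast (rev us)) \<union> outer (Suc t)" and uv: "(u, v) \<in> parcs F" for u v
  proof -
    have verts: "u \<in> pverts F" "v \<in> pverts F" using pair_graph_arcD[OF pair_graph_F uv] by auto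
    consider "u \<in> outer (Suc t)" | "u \<in> set (tl us)" using u by (auto simp: butlast_rev)
    then show ?thesis
    proof cases
      case 1
      then show ?thesis
        using stem_last[OF us verts(2)] outer_leaf_nbrs uv by (auto simp: broom_arcs_def hd_rev)
    next
      case 2
      then have fu: "1 \<le> f u" "f u \<le> t" using stem_tl[OF us] by auto
      consider "f v = Suc (f u)" "f v \<le> t" | "f u = Suc (f v)" | "f u = t" "v \<in> outer (Suc t)"
        by (rule arc_cases[OF uv]) (use fu verts in \<open>auto simp: outer_def\<close>)
      then show ?thesis
        using stem_arc[OF us verts] stem_arc[OF us verts(2,1)] stem_last[OF us verts(1)] fu
        by cases (auto simp: broom_arcs_def set_vwalk_arcs_rev hd_rev)
    qed
  qed
  then show ?thesis using stem_broom_copy[OF assms] by (auto simp: broom_end_def)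
qed

lemma card_outer_le: "card (outer 1) \<le> card (outer (Suc t)) + t"
proof -
  have fin: "finite (outer i)" for i
    by (rule finite_subset[OF outer_sub pair_graph_finite(1)[OF pair_graph_F]])
  have "card (outer 1 - outer (Suc t)) \<le> card {1..t}"
    by (rule card_inj_on_le[of f]) (use f_eq_iff in \<open>auto simp: outer_def intro: inj_onI\<close>)
  moreover have "card (outer 1 - outer (Suc t)) = card (outer 1) - card (outer (Suc t))"
    using fin by (intro card_Diff_subset) (auto simp: outer_def)
  ultimately show ?thesis by simp
qed

lemma broom_end_of_embedding:
  assumes t: "1 \<le> t" "t < card (outer 1)" and b: "b \<in> pverts F - outer 1"
  obtains zs Z where "broom_end F zs Z" "length zs = Suc t" "card (outer 1) \<le> card Z + t"
proof -
  have "outer (Suc t) \<noteq> {}" using card_outer_le t(2) by auto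
  moreover have "outer (Suc t) \<subseteq> outer t" by (auto simp: outer_def)
  ultimately obtain us where us: "stem us t" using ex_stem[OF t(1) order_refl _ b] by blast
  have "1 < v_count F"
    using card_mono[OF pair_graph_finite(1)[OF pair_graph_F] outer_sub[of 1]] t by simp
  from stem_broom_end[OF us this] show ?thesis
    by (rule that) (use stem_length[OF us] card_outer_le in auto)
qed

end

section \<open>Bicliques with an attached path and star\<close>

text \<open>
  The path \<open>0, \<dots>, 2h + c\<close>, whose vertex \<open>2h\<close> has \<open>N\<close> further leaves, and \<open>e\<close> more vertices;
  the even vertices up to \<open>2h\<close> form one side of a complete bipartite graph, and the odd ones below
  \<open>2h\<close> together with the last \<open>e\<close> vertices form the other side.
\<close>

definition biclique_adj :: "nat \<Rightarrow> nat \<Rightarrow> nat \<Rightarrow> nat \<Rightarrow> nat \<Rightarrow> bool" where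
  "biclique_adj h c N i j \<longleftrightarrow>
     j = Suc i \<and> 2 * h \<le> i \<and> j \<le> 2 * h + c \<or>
     i = 2 * h \<and> 2 * h + c < j \<and> j \<le> 2 * h + c + N \<or>
     even i \<and> i \<le> 2 * h \<and> (odd j \<and> j < 2 * h \<or> 2 * h + c + N < j)"

definition leafy_biclique :: "nat \<Rightarrow> nat \<Rightarrow> nat \<Rightarrow> nat \<Rightarrow> ngraph" where
  "leafy_biclique h c N e = mk_graph (2 * h + c + 1 + N + e) (biclique_adj h c N)"

definition biclique_part :: "nat \<Rightarrow> nat \<Rightarrow> nat \<Rightarrow> nat \<Rightarrow> nat set" where
  "biclique_part h c N e = {..2 * h} \<union> {2 * h + c + N<..<2 * h + c + 1 + N + e}"

lemma pair_graph_leafy_biclique: "pair_graph (leafy_biclique h c N e)"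
  by (simp add: leafy_biclique_def)

lemma leafy_biclique_arc_iff:
  "(i, j) \<in> parcs (leafy_biclique h c N e) \<longleftrightarrow> i < 2 * h + c + 1 + N + e \<and> j < 2 * h + c + 1 + N + e \<and>
     i \<noteq> j \<and> (biclique_adj h c N i j \<or> biclique_adj h c N j i)"
  by (simp add: leafy_biclique_def)

lemma connected_leafy_biclique: "connected_graph (leafy_biclique h c N e)"
  unfolding leafy_biclique_def
proof (rule connected_mk_graph)
  fix i :: nat assume "0 < i"
  then consider (path) "i \<le> 2 * h + c" | (leaf) "2 * h + c < i" "i \<le> 2 * h + c + N"
    | (extra) "2 * h + c + N < i"
    by linarith
  then show "\<exists>j<i. biclique_adj h c N i j \<or> biclique_adj h c N j i"
  proof cases
    case path
    then show ?thesis
      using \<open>0 < i\<close>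
      by (intro exI[of _ "i - 1"]) (cases "even i", auto simp: biclique_adj_def elim!: evenE oddE)
  next
    case leaf then show ?thesis by (intro exI[of _ "2 * h"]) (auto simp: biclique_adj_def)
  next
    case extra then show ?thesis by (intro exI[of _ 0]) (auto simp: biclique_adj_def)
  qed
qed simp

lemma twin_exchange_leafy_biclique:
  fixes h c N e e' :: nat
  defines "odds \<equiv> (\<lambda>i. 2 * i + 1) ` {..<h}"
  defines "twins \<equiv> \<lambda>e. odds \<union> {2 * h + c + N<..<2 * h + c + 1 + N + e}"
  assumes "m \<le> h + e" "m \<le> h + e'"
  shows "twin_exchange (leafy_biclique h c N e) (leafy_biclique h c N e')
    ({..2 * h + c + N} - odds) (twins e) (twins e') m"
proof -
  have odds: "i \<in> odds \<longleftrightarrow> odd i \<and> i < 2 * h" for i by (auto simp: odds_def elim!: oddE)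
  have "card odds = h" by (simp add: odds_def card_image inj_on_def)
  moreover have "finite odds" "odds \<inter> {2 * h + c + N<..<2 * h + c + 1 + N + e} = {}" for e
    by (auto simp: odds_def)
  ultimately have card: "card (twins e) = h + e" for e by (simp add: twins_def card_Un_disjoint)
  have twin: "odd b \<and> b < 2 * h \<or> 2 * h + c + N < b" "b < 2 * h + c + 1 + N + e"
    if "b \<in> twins e" for b e
    using that by (auto simp: twins_def odds)
  have mixed: "biclique_adj h c N x b \<or> biclique_adj h c N b x \<longleftrightarrow> even x \<and> x \<le> 2 * h"
    if "x \<in> {..2 * h + c + N} - odds" "b \<in> twins e" for x b e
    using that(1) twin(1)[OF that(2)] by (auto simp: biclique_adj_def odds)
  have within: "\<not> biclique_adj h c N b b'" if "b \<in> twins e" "b' \<in> twins e" for b b' e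
    using twin(1)[OF that(1)] twin(1)[OF that(2)] by (auto simp: biclique_adj_def)
  show ?thesis
  proof (rule twin_exchange.intro)
    fix x b b' assume x: "x \<in> {..2 * h + c + N} - odds" and b: "b \<in> twins e" "b' \<in> twins e'"
    have "x \<noteq> b" "x \<noteq> b'" using x twin(1)[OF b(1)] twin(1)[OF b(2)] by (auto simp: odds)
    then show "(x, b) \<in> parcs (leafy_biclique h c N e) \<longleftrightarrow> (x, b') \<in> parcs (leafy_biclique h c N e')"
      using x twin(2)[OF b(1)] twin(2)[OF b(2)] mixed[OF x b(1)] mixed[OF x b(2)]
      by (simp add: leafy_biclique_arc_iff)
  qed (use assms(3,4) card within in
      \<open>auto simp: pair_graph_leafy_biclique leafy_biclique_arc_iff twins_def odds leafy_biclique_def\<close>)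
qed

lemma leafy_biclique_contains_broom:
  assumes "pair_graph F" "is_broom F ys R" "length ys = Suc (2 * h + c)" "card R \<le> e"
  shows "leafy_biclique h c N e \<in> containing F"
proof -
  let ?H = "leafy_biclique h c N e" and ?L = "{2 * h + c + N<..<2 * h + c + 1 + N + e}"
  have "(i, Suc i) \<in> parcs ?H" if "i < 2 * h + c" for i
    using that
    by (cases "even i") (auto simp: leafy_biclique_arc_iff biclique_adj_def elim!: evenE oddE)
  then have "vpath [0..<Suc (2 * h + c)] (with_proj ?H)"
    by (auto simp: vpath_iff_successively successively_conv_nth leafy_biclique_def simp del: upt_Suc)
  then have "broom_copy ?H [0..<Suc (2 * h + c)] ?L"
    by (auto simp: broom_copy_def leafy_biclique_arc_iff biclique_adj_def simp del: upt_Suc)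
  moreover have "card R \<le> card ?L" using assms(4) by simp
  ultimately show ?thesis
    unfolding containing_is_broom_iff[OF assms(1,2) pair_graph_leafy_biclique] using assms(3)
    by (intro exI[of _ "[0..<Suc (2 * h + c)]"] exI[of _ ?L]) (simp del: upt_Suc)
qed

lemma leafy_biclique_nbrs:
  assumes "x \<noteq> 2 * h"
  shows "x \<in> biclique_part h c N e \<Longrightarrow> nbrs (leafy_biclique h c N e) x \<subseteq> biclique_part h c N e"
    and "x \<notin> biclique_part h c N e \<Longrightarrow> card (nbrs (leafy_biclique h c N e) x) \<le> 2"
proof -
  show "nbrs (leafy_biclique h c N e) x \<subseteq> biclique_part h c N e" if "x \<in> biclique_part h c N e"
    using assms that by (auto simp: leafy_biclique_arc_iff biclique_adj_def biclique_part_def)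
  assume "x \<notin> biclique_part h c N e"
  then have "nbrs (leafy_biclique h c N e) x \<subseteq> (if x \<le> 2 * h + c then {x - 1, Suc x} else {2 * h})"
    by (auto simp: leafy_biclique_arc_iff biclique_adj_def biclique_part_def)
  then have "card (nbrs (leafy_biclique h c N e) x) \<le>
      card (if x \<le> 2 * h + c then {x - 1, Suc x} else {2 * h})"
    by (rule card_mono[rotated]) simp
  also have "\<dots> \<le> 2" by (simp add: card_insert_if)
  finally show "card (nbrs (leafy_biclique h c N e) x) \<le> 2" .
qed

lemma leafy_biclique_branch_path:
  assumes us: "vpath us (with_proj (leafy_biclique h c N e))"
    and start: "2 * h \<notin> set us" "hd us \<notin> biclique_part h c N e" and c: "1 \<le> c"
  shows "length us \<le> c"
proof -
  have dist: "distinct us" and "hd us \<in> pverts (leafy_biclique h c N e)"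
    using us by (auto simp: vpath_def vwalk_def)
  then have hd: "hd us < 2 * h + c + 1 + N + e" by (simp add: leafy_biclique_def)
  have "set us \<subseteq> {2 * h<..2 * h + c} \<or> set us \<subseteq> {hd us}"
  proof (cases "hd us \<le> 2 * h + c")
    case True
    then have "set us \<subseteq> {2 * h<..2 * h + c}"
      using start hd
      by (intro vpath_closed[OF us])
        (auto simp: leafy_biclique_arc_iff biclique_adj_def biclique_part_def,
          metis le_neq_implies_less)
    then show ?thesis ..
  next
    case False
    then have "set us \<subseteq> {hd us}"
      using start hd
      by (intro vpath_closed[OF us])
        (auto simp: leafy_biclique_arc_iff biclique_adj_def biclique_part_def)
    then show ?thesis ..
  qed
  then have "card (set us) \<le> c"
    using c card_mono[of "{2 * h<..2 * h + c}" "set us"] card_mono[of "{hd us}" "set us"] by auto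
  then show ?thesis using dist by (simp add: distinct_card)
qed

lemma length_le_if_successively_meets:
  assumes "successively (\<lambda>u v. u \<in> A \<or> v \<in> A) xs" "distinct xs" "finite A"
  shows "length xs \<le> 2 * card A + 1"
proof -
  have "length xs \<le> 2 * length (filter (\<lambda>x. x \<in> A) xs) + 1"
    using assms(1) by (induction xs rule: induct_list012) (auto simp: successively_Cons)
  also have "length (filter (\<lambda>x. x \<in> A) xs) = card (set xs \<inter> A)"
    using assms(2)
    by (metis distinct_card distinct_filter set_filter Collect_conj_eq Collect_mem_eq)
  also have "\<dots> \<le> card A" using assms(3) by (intro card_mono) auto
  finally show ?thesis by simp
qed

lemma leafy_biclique_path_from_attachment:
  assumes us: "vpath us (with_proj (leafy_biclique h c N e))" "hd us = 2 * h" and "1 \<le> h" "2 \<le> c"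
  shows "length us \<le> 2 * h + c"
proof (cases "tl us = []")
  case False
  let ?H = "leafy_biclique h c N e"
  obtain vs where us_eq: "us = 2 * h # vs" using us False by (cases us) auto
  then have vs: "vpath vs (with_proj ?H)" "2 * h \<notin> set vs"
    using us(1) False by (auto simp: vpath_iff_successively successively_Cons)
  show ?thesis
  proof (cases "hd vs \<in> biclique_part h c N e")
    case False
    then have "length vs \<le> c" using leafy_biclique_branch_path[OF vs] assms(4) by simp
    then show ?thesis using us_eq assms(3) by simp
  next
    case True
    let ?A = "(\<lambda>i. 2 * i) ` {..<h}"
    have "set vs \<subseteq> biclique_part h c N e - {2 * h}"
    proof (rule vpath_closed[OF vs(1)])
      show "hd vs \<in> biclique_part h c N e - {2 * h}"
        using True vs by (metis DiffI hd_in_set singletonD vpath_iff_successively)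
    qed (use vs(2) leafy_biclique_nbrs(1) in blast)
    moreover have "i \<in> ?A \<or> j \<in> ?A"
      if "(i, j) \<in> parcs ?H" "{i, j} \<subseteq> biclique_part h c N e - {2 * h}" for i j
      using that
      by (auto simp: leafy_biclique_arc_iff biclique_adj_def biclique_part_def elim!: evenE)
    moreover have "successively (\<lambda>i j. (i, j) \<in> parcs ?H) vs"
      using vs(1) by (simp add: vpath_iff_successively)
    ultimately have "successively (\<lambda>i j. i \<in> ?A \<or> j \<in> ?A) vs"
      by (elim successively_mono) blast
    then have "length vs \<le> 2 * card ?A + 1"
      using vs(1) by (intro length_le_if_successively_meets) (auto simp: vpath_def)
    also have "card ?A = h" by (simp add: card_image inj_on_def)
    finally show ?thesis using us_eq assms(4) by simp
  qed
qed (use assms in \<open>cases us; auto\<close>)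

lemma leafy_biclique_path_card_outside:
  assumes us: "vpath us (with_proj (leafy_biclique h c N e))"
    and "hd us \<in> biclique_part h c N e" and c: "1 \<le> c"
  shows "card (set us - biclique_part h c N e) \<le> c"
proof (cases "set us \<subseteq> biclique_part h c N e")
  case False
  then have "\<exists>y\<in>set us. y \<notin> biclique_part h c N e" by blast
  then obtain as y bs where us_eq: "us = as @ y # bs" and y: "y \<notin> biclique_part h c N e"
    and as: "\<forall>x\<in>set as. x \<in> biclique_part h c N e"
    by (elim split_list_first_propE) auto
  have ne: "as \<noteq> []" using assms(2) us_eq y by auto
  have path: "vpath (y # bs) (with_proj (leafy_biclique h c N e))"
    and arc: "(last as, y) \<in> parcs (leafy_biclique h c N e)"
    using us ne by (auto simp: us_eq vpath_iff_successively successively_append_iff)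
  have "last as = 2 * h" using leafy_biclique_nbrs(1)[of "last as"] arc y as ne by fastforce
  moreover have "last as \<in> set as" using ne by simp
  ultimately have "2 * h \<notin> set (y # bs)" using us by (auto simp: us_eq vpath_def)
  then have "length (y # bs) \<le> c" using leafy_biclique_branch_path[OF path] y c by simp
  moreover have "card (set us - biclique_part h c N e) \<le> card (set (y # bs))"
    using as by (intro card_mono) (auto simp: us_eq)
  ultimately show ?thesis using card_length[of "y # bs"] by linarith
qed (simp add: Diff_eq_empty_iff[THEN iffD2])

lemma leafy_biclique_broom_copy:
  assumes copy: "broom_copy (leafy_biclique h c N e) us L" and L: "3 \<le> card L"
    and len: "2 * h + c < length us" and h: "1 \<le> h" and c: "2 \<le> c"
  shows "length us + card L \<le> 2 * h + c + 1 + e"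
proof -
  let ?H = "leafy_biclique h c N e" and ?B = "biclique_part h c N e"
  have us: "vpath us (with_proj ?H)" and nbrs: "L \<subseteq> nbrs ?H (hd us) - set us"
    using copy by (auto simp: broom_copy_def)
  have "hd us \<noteq> 2 * h" using leafy_biclique_path_from_attachment[OF us _ h c] len by auto
  moreover have "card L \<le> card (nbrs ?H (hd us))"
    using nbrs by (intro card_mono pair_graph_finite(2)[OF pair_graph_leafy_biclique]) auto
  ultimately have B: "hd us \<in> ?B" "L \<subseteq> ?B"
    using leafy_biclique_nbrs[of "hd us" h c N e] L nbrs by fastforce+
  have fin: "finite L" "finite ?B" using L card.infinite by (fastforce simp: biclique_part_def)+
  have "length us + card L = card (set us \<union> L)"
    using us nbrs fin by (subst card_Un_disjoint) (auto simp: vpath_def distinct_card)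
  also have "\<dots> \<le> card (?B \<union> (set us - ?B))" using B fin by (intro card_mono) auto
  also have "\<dots> \<le> card ?B + card (set us - ?B)" by (rule card_Un_le)
  also have "\<dots> \<le> card ?B + c"
    using leafy_biclique_path_card_outside[OF us B(1)] c by simp
  also have "card ?B = 2 * h + 1 + e"
    unfolding biclique_part_def by (subst card_Un_disjoint) auto
  finally show ?thesis by simp
qed

section \<open>Lower bound on the width\<close>

locale asymptotic_definition =
  fixes F :: ngraph and p :: fo and N :: nat
  assumes connected: "connected_graph F" and sentence_p: "sentence p"
    and defines_containing:
      "\<And>G. connected_graph G \<Longrightarrow> N \<le> v_count G \<Longrightarrow> models G p \<longleftrightarrow> G \<in> containing F"
begin

abbreviation k :: nat where "k \<equiv> width p"

text \<open>The number of vertices of \<open>F\<close> that do not fit into a clique on \<open>k + 1\<close> vertices.\<close>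

definition surplus :: nat where "surplus = v_count F - k - 1"

lemma pair_graph_F: "pair_graph F"
  using connected by (rule connected_graph_pair_graph)

lemma exchange_containing:
  assumes tw: "twin_exchange G H C B B' k" and "C \<noteq> {}"
    and G: "connected_graph G" "N \<le> v_count G" "G \<in> containing F"
    and H: "connected_graph H" "N \<le> v_count H"
  shows "H \<in> containing F"
  using twin_exchange.models_iff[OF tw sentence_p order_refl assms(2)] defines_containing G H
  by blast

lemma ex_lollipop_embedding:
  assumes "N \<le> t + s"
  obtains f where "lollipop_embedding F f t s k"
proof -
  obtain g where "embedding F (leafy_lollipop t s (k + v_count F)) g"
    using embedding_leafy_lollipop[OF pair_graph_F] by blast
  then have "leafy_lollipop t s (k + v_count F) \<in> containing F"
    using containing_iff_embedding[OF pair_graph_F pair_graph_leafy_lollipop] by blast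
  then have "leafy_lollipop t s k \<in> containing F"
    by (rule exchange_containing[OF twin_exchange_leafy_lollipop, rotated 5])
      (use assms in \<open>auto simp: connected_leafy_lollipop, auto simp: leafy_lollipop_def\<close>)
  then obtain f where "embedding F (leafy_lollipop t s k) f"
    using containing_iff_embedding[OF pair_graph_F pair_graph_leafy_lollipop] by blast
  then show ?thesis using connected by (intro that) (rule lollipop_embedding.intro)
qed

context
  assumes large_surplus: "3 \<le> surplus"
begin

lemma v_count_eq: "v_count F = surplus + k + 1"
  using large_surplus by (simp add: surplus_def)

lemma ex_star:
  obtains c L where "surplus \<le> card L" "\<And>l. l \<in> L \<Longrightarrow> nbrs F l = {c}"
proof -
  obtain f where "lollipop_embedding F f 0 N k" using ex_lollipop_embedding[of 0 N] by auto
  then interpret lollipop_embedding F f 0 N k .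
  obtain c where "\<And>l. l \<in> outer 1 \<Longrightarrow> nbrs F l = {c}"
    using star_of_embedding large_surplus v_count_eq by auto
  moreover have "surplus \<le> card (outer 1)" using v_count_le_card_outer v_count_eq by simp
  ultimately show ?thesis using that by blast
qed

lemma ex_pendant_path:
  obtains ys where "pendant_path F ys" "surplus < length ys"
proof -
  obtain f where "lollipop_embedding F f N 0 k" using ex_lollipop_embedding[of N 0] by auto
  then interpret lollipop_embedding F f N 0 k .
  have surplus_le: "surplus \<le> card (outer 1)" using v_count_le_card_outer v_count_eq by simp
  obtain c L where L: "surplus \<le> card L" "\<And>l. l \<in> L \<Longrightarrow> nbrs F l = {c}" by (rule ex_star) blast
  have "L \<subseteq> nbrs F c" using L(2) pair_graph_arcD(4)[OF pair_graph_F] by blast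
  then have "card L \<le> card (nbrs F c)" by (rule card_mono[OF pair_graph_finite(2)[OF pair_graph_F]])
  then have "c \<notin> outer 1" using outer_card_nbrs L(1) large_surplus by fastforce
  moreover have "c \<in> pverts F"
  proof -
    have "L \<noteq> {}" using L(1) large_surplus by auto
    then obtain l where "l \<in> L" by blast
    then have "(l, c) \<in> parcs F" using L(2) by blast
    then show ?thesis using pair_graph_arcD(2)[OF pair_graph_F] by blast
  qed
  ultimately have c: "c \<in> pverts F - outer 1" by blast
  have "outer 1 \<noteq> {}" using surplus_le large_surplus by auto
  then obtain ys where "pendant_path F ys" "card (outer 1) < length ys"
    using pendant_path_of_embedding[OF refl _ c] by blast
  then show ?thesis using surplus_le by (intro that) auto
qed

lemma ex_broom_end:
  obtains zs Z where "broom_end F zs Z" "length zs = surplus - 1" "2 \<le> card Z"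
proof -
  obtain f where "lollipop_embedding F f (surplus - 2) N k"
    using ex_lollipop_embedding[of "surplus - 2" N] by auto
  then interpret lollipop_embedding F f "surplus - 2" N k .
  have surplus_le: "surplus \<le> card (outer 1)" using v_count_le_card_outer v_count_eq by simp
  obtain ys where ys: "pendant_path F ys" "surplus < length ys" by (rule ex_pendant_path)
  obtain b where "b \<in> pverts F - outer 1"
    by (rule pendant_path_reaches_clique[OF ys(1)]) (use ys(2) large_surplus in auto)
  then obtain zs Z where "broom_end F zs Z" "length zs = Suc (surplus - 2)"
    "card (outer 1) \<le> card Z + (surplus - 2)"
    by (rule broom_end_of_embedding[rotated 2]) (use surplus_le large_surplus in auto)
  then show ?thesis using surplus_le large_surplus by (intro that[of zs Z]) auto
qed

lemma surplus_le_if_broom_end_disjoint_pendant_path: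
  assumes ys: "pendant_path F ys" "surplus < length ys"
    and zs: "broom_end F zs Z" "length zs = surplus - 1" "2 \<le> card Z"
    and disjoint: "set (tl ys) \<inter> set (butlast zs) = {}"
  shows "3 * surplus \<le> v_count F + 2"
proof -
  obtain c L where L: "surplus \<le> card L" "\<And>l. l \<in> L \<Longrightarrow> nbrs F l = {c}" by (rule ex_star) blast
  have L_sub: "L \<subseteq> pverts F" using L(2) pair_graph_arcD(1)[OF pair_graph_F, of _ c] by auto
  have fin: "finite L" using finite_subset[OF L_sub pair_graph_finite(1)[OF pair_graph_F]] .
  have paths: "distinct ys" "distinct zs" "set ys \<subseteq> pverts F" "set zs \<subseteq> pverts F"
    using ys(1) zs(1)
    by (auto simp: pendant_path_def broom_end_def broom_copy_def vpath_iff_successively)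
  have "L \<inter> set (tl ys) = {}"
    using pendant_path_disjoint_leaves[OF pair_graph_F ys(1) _ L(2)] ys(2) L(1) large_surplus
    by simp
  moreover have "L \<inter> set (butlast zs) = {}"
    using broom_end_card_nbrs[OF pair_graph_F zs(1,3)] L(2) by fastforce
  ultimately have "card (L \<union> set (tl ys) \<union> set (butlast zs)) =
      card L + (length ys - 1) + (surplus - 2)"
    using disjoint fin paths(1,2) zs(2)
    by (simp add: card_Un_disjoint Int_Un_distrib2 distinct_card distinct_tl distinct_butlast)
  moreover have "set (tl ys) \<subseteq> set ys" by (cases ys) auto
  then have "L \<union> set (tl ys) \<union> set (butlast zs) \<subseteq> pverts F"
    using L_sub paths(3,4) by (auto dest: in_set_butlastD)
  then have "card (L \<union> set (tl ys) \<union> set (butlast zs)) \<le> v_count F"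
    by (rule card_mono[OF pair_graph_finite(1)[OF pair_graph_F]])
  ultimately show ?thesis using L(1) ys(2) large_surplus by linarith
qed

lemma surplus_le_or_is_broom:
  obtains "3 * surplus \<le> v_count F + 2"
  | ys R where "is_broom F ys R" "surplus < length ys" "surplus \<le> card R"
proof -
  obtain xs where xs: "pendant_path F xs" "surplus < length xs" by (rule ex_pendant_path)
  obtain ys where ys: "pendant_path F ys" "\<And>xs. pendant_path F xs \<Longrightarrow> length xs \<le> length ys"
    using ex_maximal_pendant_path[OF pair_graph_F xs(1)] by blast
  have len: "surplus < length ys" using ys(2)[OF xs(1)] xs(2) by simp
  obtain c L where L: "surplus \<le> card L" "\<And>l. l \<in> L \<Longrightarrow> nbrs F l = {c}" by (rule ex_star) blast
  obtain zs Z where zs: "broom_end F zs Z" "length zs = surplus - 1" "2 \<le> card Z"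
    by (rule ex_broom_end)
  show ?thesis
  proof (cases "set (tl ys) \<inter> set (butlast zs) = {}")
    case True
    then show ?thesis
      by (rule that(1)[OF surplus_le_if_broom_end_disjoint_pendant_path[OF ys(1) len zs]])
  next
    case meet: False
    have "hd ys = hd zs"
      using broom_end_meets_maximal_pendant_path[OF pair_graph_F ys zs(1,3) meet] by simp
    then have "hd ys \<notin> L"
      using broom_end_hd_nbrs[OF pair_graph_F zs(1,3)] L(2) zs(2) large_surplus by fastforce
    moreover have "L \<inter> set (tl ys) = {}"
      using pendant_path_disjoint_leaves[OF pair_graph_F ys(1) _ L(2)] len L(1) large_surplus
      by simp
    moreover have "L \<subseteq> pverts F" using L(2) pair_graph_arcD(1)[OF pair_graph_F, of _ c] by auto
    ultimately have "L \<subseteq> pverts F - set ys" by (cases ys) auto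
    then have "surplus \<le> card (pverts F - set ys)"
      using L(1) card_mono[of "pverts F - set ys" L] pair_graph_finite(1)[OF pair_graph_F] by simp
    then show ?thesis
      using is_broom_if_broom_end_meets_pendant_path[OF connected ys zs(1,3) meet] len
      by (intro that(2))
  qed
qed

lemma surplus_le_if_is_broom:
  assumes ys: "is_broom F ys R" and len: "surplus < length ys" and R: "surplus \<le> card R"
  shows "3 * surplus \<le> v_count F + 2"
proof (rule ccontr)
  assume large: "\<not> ?thesis"
  have "pverts F = set ys \<union> R" "R \<inter> set ys = {}" "distinct ys"
    using ys by (auto simp: is_broom_def broom_copy_def vpath_def)
  then have v_count: "v_count F = length ys + card R"
    using pair_graph_finite(1)[OF pair_graph_F]
    by (simp add: card_Un_disjoint Int_commute distinct_card)
  define q where "q = length ys - 1"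
  define h where "h = q div 2 - 1"
  define c where "c = q mod 2 + 2"
  have q: "length ys = Suc q" "4 \<le> q" "q \<le> k"
    using v_count v_count_eq len R large large_surplus by (auto simp: q_def)
  have q_eq: "q = 2 * h + c" "1 \<le> h" "2 \<le> c" "h \<le> k" "q \<le> 2 * h + 3"
    using q(2,3) unfolding h_def c_def by presburger+
  have "leafy_biclique h c N (k - h + card R) \<in> containing F"
    by (rule leafy_biclique_contains_broom[OF pair_graph_F ys]) (use q(1) q_eq(1) in auto)
  then have "leafy_biclique h c N (k - h) \<in> containing F"
    by (rule exchange_containing[OF twin_exchange_leafy_biclique, rotated 5])
      (use q_eq in \<open>auto simp: connected_leafy_biclique, auto simp: leafy_biclique_def\<close>)
  then obtain us L where us: "broom_copy (leafy_biclique h c N (k - h)) us L"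
    "length us = Suc q" "card R \<le> card L"
    unfolding containing_is_broom_iff[OF pair_graph_F ys pair_graph_leafy_biclique] q(1) by blast
  then have "length us + card L \<le> 2 * h + c + 1 + (k - h)"
    using large_surplus R q_eq by (intro leafy_biclique_broom_copy) auto
  then have "v_count F \<le> q + 1 + (k - h)" using us(2,3) v_count q(1) q_eq(1) by linarith
  then show False using large v_count_eq q_eq(4,5) q(3) by linarith
qed

end

lemma surplus_le: "3 * surplus \<le> v_count F + 2"
proof (cases "3 \<le> surplus")
  case True
  then show ?thesis by (rule surplus_le_or_is_broom) (use surplus_le_if_is_broom True in blast)+
next
  case False
  then show ?thesis using width_pos[of p] unfolding surplus_def by linarith
qed

end

theorem width_lower_bound:
  assumes "connected_graph F"
  shows "2 / 3 * real (v_count F) - 2 < real (W' F)"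
proof -
  obtain p where p: "defines_asymptotically p (containing F)" "width p = W' F"
    using LeastI_ex[of "\<lambda>w. \<exists>p. defines_asymptotically p (containing F) \<and> width p = w"]
      ex_defines_asymptotically[OF assms] unfolding W'_def by blast
  then obtain N where
    "\<And>G. connected_graph G \<Longrightarrow> N \<le> v_count G \<Longrightarrow> models G p \<longleftrightarrow> G \<in> containing F"
    unfolding defines_asymptotically_def by blast
  then interpret asymptotic_definition F p N
    using assms p by unfold_locales (auto simp: defines_asymptotically_def)
  show ?thesis using surplus_le p(2) unfolding surplus_def by linarith
qed

section \<open>Ehrenfeucht games\<close>

definition partial_iso ::
  "'a pair_pre_digraph \<Rightarrow> 'b pair_pre_digraph \<Rightarrow> 'a set \<Rightarrow> ('a \<Rightarrow> 'b) \<Rightarrow> bool" where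
  "partial_iso G H X \<tau> \<longleftrightarrow> inj_on \<tau> X \<and> \<tau> ` X \<subseteq> pverts H \<and>
     (\<forall>x\<in>X. \<forall>y\<in>X. (\<tau> x, \<tau> y) \<in> parcs H \<longleftrightarrow> (x, y) \<in> parcs G)"

primrec duplicator_wins ::
  "'a pair_pre_digraph \<Rightarrow> 'b pair_pre_digraph \<Rightarrow> nat \<Rightarrow> 'a set \<Rightarrow> ('a \<Rightarrow> 'b) \<Rightarrow> bool" where
  "duplicator_wins G H 0 X \<tau> \<longleftrightarrow> partial_iso G H X \<tau>"
| "duplicator_wins G H (Suc d) X \<tau> \<longleftrightarrow> partial_iso G H X \<tau> \<and>
     (\<forall>a\<in>pverts G - X. \<exists>b\<in>pverts H. duplicator_wins G H d (insert a X) (\<tau>(a := b))) \<and>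
     (\<forall>b\<in>pverts H - \<tau> ` X. \<exists>a\<in>pverts G - X. duplicator_wins G H d (insert a X) (\<tau>(a := b)))"

lemma duplicator_wins_partial_iso: "duplicator_wins G H d X \<tau> \<Longrightarrow> partial_iso G H X \<tau>"
  by (cases d) auto

lemma partial_iso_arc_iff:
  "partial_iso G H X \<tau> \<Longrightarrow> x \<in> X \<Longrightarrow> y \<in> X \<Longrightarrow> (\<tau> x, \<tau> y) \<in> parcs H \<longleftrightarrow> (x, y) \<in> parcs G"
  by (simp add: partial_iso_def)

lemma vpath_partial_iso:
  assumes "partial_iso G H X \<tau>" "vpath us (with_proj G)" "set us \<subseteq> X"
  shows "vpath (map \<tau> us) (with_proj H)"
proof -
  have "successively (\<lambda>u v. (\<tau> u, \<tau> v) \<in> parcs H) us"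
    by (rule successively_mono[of "\<lambda>u v. (u, v) \<in> parcs G"])
      (use assms(2) in \<open>simp add: vpath_iff_successively\<close>,
       use assms(3) partial_iso_arc_iff[OF assms(1)] in blast)
  then show ?thesis
    using assms
    by (auto simp: vpath_iff_successively partial_iso_def distinct_map successively_map
        intro: inj_on_subset)
qed

lemma duplicator_wins_extend:
  assumes "duplicator_wins G H d X \<tau>" "finite Y" "Y \<subseteq> pverts G" "X \<inter> Y = {}" "card Y \<le> d"
  obtains \<sigma> where "duplicator_wins G H (d - card Y) (X \<union> Y) \<sigma>" "\<And>x. x \<in> X \<Longrightarrow> \<sigma> x = \<tau> x"
proof -
  have "\<exists>\<sigma>. duplicator_wins G H (d - card Y) (X \<union> Y) \<sigma> \<and> (\<forall>x\<in>X. \<sigma> x = \<tau> x)"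
    using assms(2,1,3-5)
  proof (induction Y arbitrary: d X \<tau> rule: finite_induct)
    case (insert y Y)
    then obtain d' where d: "d = Suc d'" by (cases d) auto
    obtain b where b: "duplicator_wins G H d' (insert y X) (\<tau>(y := b))"
      using insert.prems(1-3) unfolding d duplicator_wins.simps by blast
    then obtain \<sigma> where \<sigma>: "duplicator_wins G H (d' - card Y) (insert y X \<union> Y) \<sigma>"
      "\<forall>x\<in>insert y X. \<sigma> x = (\<tau>(y := b)) x"
      using insert.IH[OF b] insert.prems insert.hyps d by auto
    have "\<sigma> x = \<tau> x" if "x \<in> X" for x using \<sigma>(2) that insert.prems(3) by auto
    then show ?case using \<sigma>(1) insert.hyps d by (intro exI[of _ \<sigma>]) auto
  qed auto
  then show ?thesis using that by blast
qed

lemma duplicator_wins_partial_iso_extend: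
  assumes "duplicator_wins G H d X \<tau>" "finite Y" "Y \<subseteq> pverts G" "X \<inter> Y = {}" "card Y \<le> d"
  obtains \<sigma> where "partial_iso G H (X \<union> Y) \<sigma>" "\<And>x. x \<in> X \<Longrightarrow> \<sigma> x = \<tau> x"
  by (rule duplicator_wins_extend[OF assms]) (use that duplicator_wins_partial_iso in blast)

definition diagram :: "fo list \<Rightarrow> fo set \<Rightarrow> fo \<Rightarrow> fo" where
  "diagram ps T q = foldr Conj (map (\<lambda>p. if p \<in> T then p else Neg p) ps) q"

lemma sat_diagram:
  "sat G e (diagram ps T q) \<longleftrightarrow> (\<forall>p\<in>set ps. sat G e p \<longleftrightarrow> p \<in> T) \<and> sat G e q"
  unfolding diagram_def sat_foldr_Conj set_map ball_simps
  by (intro conj_cong ball_cong refl) simp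

lemma qdepth_diagram:
  "(\<And>p. p \<in> set ps \<Longrightarrow> qdepth p \<le> d) \<Longrightarrow> qdepth q \<le> d \<Longrightarrow> qdepth (diagram ps T q) \<le> d"
  unfolding diagram_def by (induction ps) auto

lemma free_vars_diagram:
  "free_vars (diagram ps T q) = (\<Union>p\<in>set ps. free_vars p) \<union> free_vars q"
  unfolding diagram_def free_vars_foldr_Conj by (auto split: if_splits)

definition atoms :: "nat \<Rightarrow> fo list" where
  "atoms m = [Adj i j. i \<leftarrow> [0..<m], j \<leftarrow> [0..<m]] @ [Eq i j. i \<leftarrow> [0..<m], j \<leftarrow> [0..<m]]"

primrec test_formulas :: "nat \<Rightarrow> nat \<Rightarrow> fo list" where
  "test_formulas 0 m = atoms m"
| "test_formulas (Suc d) m = atoms m @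
     map (\<lambda>T. Exi m (diagram (test_formulas d (Suc m)) (set T) (Eq m m)))
       (subseqs (test_formulas d (Suc m)))"

lemma mem_set_atoms_iff: "p \<in> set (atoms m) \<longleftrightarrow> (\<exists>i<m. \<exists>j<m. p = Adj i j \<or> p = Eq i j)"
  by (auto simp: atoms_def image_iff)

lemma atoms_subset_test_formulas: "set (atoms m) \<subseteq> set (test_formulas d m)"
  by (cases d) auto

lemma test_formulas_bounds:
  "p \<in> set (test_formulas d m) \<Longrightarrow> qdepth p \<le> d \<and> free_vars p \<subseteq> {..<m}"
proof (induction d arbitrary: m p)
  case 0
  then show ?case by (auto simp: mem_set_atoms_iff)
next
  case (Suc d)
  show ?case
  proof (cases "p \<in> set (atoms m)")
    case False
    then obtain T where p: "p = Exi m (diagram (test_formulas d (Suc m)) T (Eq m m))"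
      using Suc.prems by auto
    have "qdepth (diagram (test_formulas d (Suc m)) T (Eq m m)) \<le> d"
      by (rule qdepth_diagram) (use Suc.IH in auto)
    moreover have "free_vars (diagram (test_formulas d (Suc m)) T (Eq m m)) \<subseteq> insert m {..<m}"
      using Suc.IH[of _ "Suc m"] by (auto simp: free_vars_diagram lessThan_Suc)
    ultimately show ?thesis by (auto simp: p)
  qed (auto simp: mem_set_atoms_iff)
qed

lemma test_formulas_extend:
  assumes same: "\<And>p. p \<in> set (test_formulas (Suc d) m) \<Longrightarrow> sat G e p \<longleftrightarrow> sat H e' p"
    and a: "a \<in> pverts G"
  shows "\<exists>b\<in>pverts H. \<forall>p\<in>set (test_formulas d (Suc m)). sat G (e(m := a)) p \<longleftrightarrow> sat H (e'(m := b)) p"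
proof -
  let ?ps = "test_formulas d (Suc m)"
  define T where "T = {p\<in>set ?ps. sat G (e(m := a)) p}"
  have "T \<in> set ` set (subseqs ?ps)" by (auto simp: subseqs_powset T_def)
  then have "Exi m (diagram ?ps T (Eq m m)) \<in> set (test_formulas (Suc d) m)" by auto
  moreover have "sat G e (Exi m (diagram ?ps T (Eq m m)))"
    using a by (auto simp: sat_diagram T_def)
  ultimately have "sat H e' (Exi m (diagram ?ps T (Eq m m)))" using same by blast
  then show ?thesis by (auto simp: sat_diagram T_def)
qed

lemma partial_iso_if_atoms_agree:
  assumes "\<And>p. p \<in> set (atoms m) \<Longrightarrow> sat G e p \<longleftrightarrow> sat H (\<tau> \<circ> e) p"
    and "\<tau> ` e ` {..<m} \<subseteq> pverts H"
  shows "partial_iso G H (e ` {..<m}) \<tau>"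
proof -
  have "sat G e p \<longleftrightarrow> sat H (\<tau> \<circ> e) p" if "p \<in> {Adj i j, Eq i j}" "i < m" "j < m" for i j p
    by (rule assms(1)) (use that in \<open>auto simp: mem_set_atoms_iff\<close>)
  then show ?thesis using assms(2) by (force simp: partial_iso_def inj_on_def)
qed

lemma sat_fun_upd_test_formulas:
  assumes p: "p \<in> set (test_formulas d (Suc m))" and "a \<notin> e ` {..<m}"
  shows "sat H (\<tau>(a := b) \<circ> e(m := a)) p \<longleftrightarrow> sat H ((\<tau> \<circ> e)(m := b)) p"
  by (rule sat_cong) (use test_formulas_bounds[OF p] assms(2) in \<open>auto simp: less_Suc_eq\<close>)

lemma fresh_if_test_formulas_agree:
  assumes same: "\<And>p. p \<in> set (test_formulas d (Suc m)) \<Longrightarrow> sat G (e(m := a)) p \<longleftrightarrow> sat H (e'(m := b)) p"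
    and "b \<notin> e' ` {..<m}"
  shows "a \<notin> e ` {..<m}"
proof
  assume "a \<in> e ` {..<m}"
  then obtain i where i: "i < m" "a = e i" by auto
  then have "Eq i m \<in> set (test_formulas d (Suc m))"
    using atoms_subset_test_formulas by (force simp: mem_set_atoms_iff)
  from same[OF this] show False using i assms(2) by auto
qed

lemma duplicator_wins_if_test_formulas_agree:
  assumes "\<And>p. p \<in> set (test_formulas d m) \<Longrightarrow> sat G e p \<longleftrightarrow> sat H (\<tau> \<circ> e) p"
    and "\<tau> ` e ` {..<m} \<subseteq> pverts H"
  shows "duplicator_wins G H d (e ` {..<m}) \<tau>"
  using assms
proof (induction d arbitrary: m e \<tau>)
  case 0
  then show ?case
    unfolding test_formulas.simps duplicator_wins.simps by (rule partial_iso_if_atoms_agree)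
next
  case (Suc d)
  have extend: "duplicator_wins G H d (insert a (e ` {..<m})) (\<tau>(a := b))"
    if ab: "a \<notin> e ` {..<m}" "b \<in> pverts H"
      and same: "\<And>p. p \<in> set (test_formulas d (Suc m)) \<Longrightarrow>
        sat G (e(m := a)) p \<longleftrightarrow> sat H ((\<tau> \<circ> e)(m := b)) p" for a b
  proof -
    have "duplicator_wins G H d (e(m := a) ` {..<Suc m}) (\<tau>(a := b))"
    proof (rule Suc.IH)
      show "sat G (e(m := a)) p \<longleftrightarrow> sat H (\<tau>(a := b) \<circ> e(m := a)) p"
        if "p \<in> set (test_formulas d (Suc m))" for p
        using same[OF that] sat_fun_upd_test_formulas[OF that ab(1)] by blast
    qed (use Suc.prems(2) ab in \<open>auto simp: lessThan_Suc\<close>)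
    moreover have "e(m := a) ` {..<Suc m} = insert a (e ` {..<m})" by (auto simp: lessThan_Suc)
    ultimately show ?thesis by simp
  qed
  have "\<exists>b\<in>pverts H. duplicator_wins G H d (insert a (e ` {..<m})) (\<tau>(a := b))"
    if "a \<in> pverts G - e ` {..<m}" for a
    using test_formulas_extend[of d m G e H "\<tau> \<circ> e" a] Suc.prems(1) extend that
    by (meson DiffD1 DiffD2)
  moreover have "\<exists>a\<in>pverts G - e ` {..<m}. duplicator_wins G H d (insert a (e ` {..<m})) (\<tau>(a := b))"
    if b: "b \<in> pverts H - \<tau> ` e ` {..<m}" for b
  proof -
    obtain a where a: "a \<in> pverts G" and same: "\<And>p. p \<in> set (test_formulas d (Suc m)) \<Longrightarrow>
        sat H ((\<tau> \<circ> e)(m := b)) p \<longleftrightarrow> sat G (e(m := a)) p"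
      using test_formulas_extend[of d m H "\<tau> \<circ> e" G e b] Suc.prems(1) b by blast
    have "a \<notin> e ` {..<m}"
      using fresh_if_test_formulas_agree[of d m G e a H "\<tau> \<circ> e" b] same b by auto
    then show ?thesis using extend[of a b] same a b by auto
  qed
  moreover have "partial_iso G H (e ` {..<m}) \<tau>"
    using Suc.prems atoms_subset_test_formulas by (intro partial_iso_if_atoms_agree) blast+
  ultimately show ?case by auto
qed

lemma sat_foldr_Disj:
  "sat G e (foldr Disj ps q) \<longleftrightarrow> (\<exists>p\<in>set ps. sat G e p) \<or> sat G e q"
  by (induction ps) auto

lemma qdepth_foldr_Disj:
  "(\<And>p. p \<in> set ps \<Longrightarrow> qdepth p \<le> d) \<Longrightarrow> qdepth q \<le> d \<Longrightarrow> qdepth (foldr Disj ps q) \<le> d"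
  by (induction ps) auto

lemma free_vars_foldr_Disj:
  "free_vars (foldr Disj ps q) = (\<Union>p\<in>set ps. free_vars p) \<union> free_vars q"
  by (induction ps) auto

lemma game_invariant_definable:
  assumes "1 \<le> d"
    and invariant: "\<And>G H \<tau>. P G \<Longrightarrow> P H \<Longrightarrow> duplicator_wins G H d {} \<tau> \<Longrightarrow> G \<in> \<C> \<Longrightarrow> H \<in> \<C>"
    and nonempty: "\<And>G. P G \<Longrightarrow> pverts G \<noteq> {}"
  obtains p where "sentence p" "qdepth p \<le> d" "\<And>G. P G \<Longrightarrow> models G p \<longleftrightarrow> G \<in> \<C>"
proof -
  define ps where "ps = test_formulas d 0"
  define holds where "holds G = {p\<in>set ps. sat G id p}" for G
  define Ts where "Ts = filter (\<lambda>T. \<exists>G\<in>\<C>. P G \<and> holds G = T) (map set (subseqs ps))"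
  define true where "true = All 0 (Eq 0 0)"
  define p where "p = foldr Disj (map (\<lambda>T. diagram ps T true) Ts) (Neg true)"
  have true: "sat G e true" "qdepth true = 1" "free_vars true = {}" for G e by (auto simp: true_def)
  have ps: "qdepth r \<le> d" "free_vars r = {}" if "r \<in> set ps" for r
    using test_formulas_bounds[of r d 0] that by (auto simp: ps_def)
  have "set Ts = {holds G |G. G \<in> \<C> \<and> P G}"
    using subseqs_powset[of ps] by (force simp: Ts_def holds_def)
  then have sat_p: "sat G id p \<longleftrightarrow> (\<exists>G'. G' \<in> \<C> \<and> P G' \<and> holds G' = holds G)" for G
    by (auto simp: p_def sat_foldr_Disj sat_diagram true holds_def)
  have "G \<in> \<C>" if "P G" "P G'" "G' \<in> \<C>" "holds G' = holds G" for G G'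
  proof -
    have "sat G' id r \<longleftrightarrow> sat G (id \<circ> id) r" if "r \<in> set ps" for r
      using \<open>holds G' = holds G\<close> that by (auto simp: holds_def)
    then have "duplicator_wins G' G d (id ` {..<0}) id"
      by (intro duplicator_wins_if_test_formulas_agree) (auto simp: ps_def)
    then show ?thesis using invariant that by auto
  qed
  moreover have sentence: "sentence p"
    by (auto simp: sentence_def p_def free_vars_foldr_Disj free_vars_diagram true ps)
  ultimately have "models G p \<longleftrightarrow> G \<in> \<C>" if "P G" for G
    using models_sentence_iff[OF sentence nonempty[OF that]] sat_p that by metis
  moreover have "qdepth p \<le> d"
    unfolding p_def using assms(1) ps true
    by (intro qdepth_foldr_Disj) (auto intro!: qdepth_diagram)
  ultimately show ?thesis using that sentence by blast
qed

section \<open>Counting and inserting along paths\<close>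

fun count_successively :: "('a \<Rightarrow> 'a \<Rightarrow> bool) \<Rightarrow> 'a list \<Rightarrow> nat" where
  "count_successively R (x # y # zs) = of_bool (R x y) + count_successively R (y # zs)"
| "count_successively R _ = 0"

lemma count_successively_append_le:
  "count_successively R xs + count_successively R ys \<le> count_successively R (xs @ ys)"
  by (induction R xs rule: count_successively.induct) (auto, cases ys, auto)

lemma count_successively_snoc:
  "xs \<noteq> [] \<Longrightarrow> count_successively R (xs @ [x]) = count_successively R xs + of_bool (R (last xs) x)"
  by (induction R xs rule: count_successively.induct) auto

lemma count_successively_rev:
  "(\<And>x y. R x y \<longleftrightarrow> R y x) \<Longrightarrow> count_successively R (rev xs) = count_successively R xs"
  by (induction R xs rule: count_successively.induct)
    (auto simp: count_successively_snoc[of "rev _ @ [_]", simplified])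

lemma count_successively_split:
  "count_successively R xs =
    count_successively (\<lambda>x y. R x y \<and> Q x y) xs + count_successively (\<lambda>x y. R x y \<and> \<not> Q x y) xs"
  by (induction R xs rule: count_successively.induct) auto

lemma count_successively_tl_le: "count_successively R (tl xs) \<le> count_successively R xs"
  by (cases xs rule: remdups_adj.cases) auto

lemma length_filter_le_count_successively:
  "length (filter P xs) \<le>
    count_successively (\<lambda>x y. P x \<and> P y) xs + length (filter (\<lambda>x. \<not> P x) xs) + 1"
proof (induction xs rule: induct_list012)
  case (3 x y zs)
  then show ?case using count_successively_tl_le[of "\<lambda>x y. P x \<and> P y" "y # zs"] by auto
qed auto

fun alternating_arcs :: "'a list \<Rightarrow> ('a \<times> 'a) list" where
  "alternating_arcs (x # y # zs) = (x, y) # alternating_arcs zs"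
| "alternating_arcs _ = []"

lemma count_successively_alternating:
  "count_successively R xs = length (filter (case_prod R) (alternating_arcs xs)) +
     length (filter (case_prod R) (alternating_arcs (tl xs)))"
  by (induction R xs rule: count_successively.induct) auto

lemma set_alternating_arcs_subset: "set (alternating_arcs xs) \<subseteq> set (vwalk_arcs xs)"
proof (induction xs rule: alternating_arcs.induct)
  case (1 x y zs)
  then show ?case using set_vwalk_arcs_cons[of zs y] by auto
qed auto

definition disjoint_arcs :: "('a \<times> 'a) set \<Rightarrow> bool" where
  "disjoint_arcs M \<longleftrightarrow> pairwise (\<lambda>a b. {fst a, snd a} \<inter> {fst b, snd b} = {}) M"

lemma disjoint_alternating_arcs:
  "distinct xs \<Longrightarrow> disjoint_arcs (set (alternating_arcs xs)) \<and> distinct (alternating_arcs xs)"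
proof (induction xs rule: alternating_arcs.induct)
  case (1 x y zs)
  have "set (alternating_arcs zs) \<subseteq> set zs \<times> set zs"
    using set_alternating_arcs_subset[of zs] arcs_in_vwalk_arcs by blast
  then show ?case using 1 by (fastforce simp: disjoint_arcs_def pairwise_insert)
qed (auto simp: disjoint_arcs_def)

lemma vpath_insert_between:
  assumes G: "pair_graph G" and "vpath xs (with_proj G)" "L \<subseteq> pverts G" "L \<inter> set xs = {}"
    and S: "\<And>l s. l \<in> L \<Longrightarrow> s \<in> S \<Longrightarrow> (s, l) \<in> parcs G"
    and "n \<le> count_successively (\<lambda>x y. x \<in> S \<and> y \<in> S) xs" "n \<le> card L"
  shows "\<exists>ys. vpath ys (with_proj G) \<and> hd ys = hd xs \<and> length ys = length xs + n \<and>
    set ys \<subseteq> set xs \<union> L"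
  using assms(2-4,6,7) S
proof (induction xs arbitrary: n L rule: induct_list012)
  case (3 x y zs)
  have path: "vpath (y # zs) (with_proj G)" and xy: "(x, y) \<in> parcs G"
    and x: "x \<in> pverts G" "x \<notin> set (y # zs)"
    using "3.prems"(1) by (auto simp: vpath_iff_successively)
  show ?case
  proof (cases "x \<in> S \<and> y \<in> S \<and> 0 < n")
    case True
    then obtain n' where n: "n = Suc n'" by (cases n) auto
    then obtain l where l: "l \<in> L" using "3.prems"(5) by fastforce
    have "n' \<le> card (L - {l})" using "3.prems"(5) l n by (simp add: card_Diff_singleton)
    moreover have "n' \<le> count_successively (\<lambda>x y. x \<in> S \<and> y \<in> S) (y # zs)"
      using "3.prems"(4) True n by simp
    ultimately obtain ys where ys: "vpath ys (with_proj G)" "hd ys = y"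
      "length ys = length (y # zs) + n'" "set ys \<subseteq> set (y # zs) \<union> (L - {l})"
      using "3.IH"(2)[OF path, of "L - {l}" n'] "3.prems"(2,3,6) by fastforce
    have "(x, l) \<in> parcs G" "(l, y) \<in> parcs G"
      using "3.prems"(6)[OF l] True pair_graph_arcD(4)[OF G] by auto
    then have "vpath (x # l # ys) (with_proj G)"
      using ys x l "3.prems"(2,3) by (auto simp: vpath_iff_successively successively_Cons)
    then show ?thesis using ys n l by (intro exI[of _ "x # l # ys"]) auto
  next
    case False
    then have "n \<le> count_successively (\<lambda>x y. x \<in> S \<and> y \<in> S) (y # zs)"
      using "3.prems"(4) by (cases "n = 0") auto
    then obtain ys where ys: "vpath ys (with_proj G)" "hd ys = y"
      "length ys = length (y # zs) + n" "set ys \<subseteq> set (y # zs) \<union> L"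
      using "3.IH"(2)[OF path, of L n] "3.prems"(2,3,5,6) by fastforce
    then have "vpath (x # ys) (with_proj G)"
      using x xy "3.prems"(3) by (auto simp: vpath_iff_successively successively_Cons)
    then show ?thesis using ys by (intro exI[of _ "x # ys"]) auto
  qed
qed (auto intro: exI[of _ "[_]"])

lemma vpath_to_set:
  assumes G: "connected_graph G" and "v \<in> pverts G" "w \<in> X" "w \<in> pverts G"
  obtains ps x where "vpath (ps @ [x]) (with_proj G)" "hd (ps @ [x]) = v" "x \<in> X" "set ps \<inter> X = {}"
proof -
  interpret pair_graph G using G by (rule connected_graph_pair_graph)
  obtain p where p: "vpath p (with_proj G)" "hd p = v" "last p = w"
    using connected_graph_reachable[OF G assms(2,4)] reachable_vpath_conv by blast
  then have "w \<in> set p" by (auto simp: vpath_iff_successively)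
  then have "\<exists>x\<in>set p. x \<in> X" using assms(3) by blast
  then obtain ps x zs where split: "p = ps @ x # zs" "x \<in> X" "\<forall>y\<in>set ps. y \<notin> X"
    by (rule split_list_first_propE)
  have "vpath (ps @ [x]) (with_proj G)"
    using p(1) by (auto simp: split(1) vpath_iff_successively successively_append_iff)
  moreover have "hd (ps @ [x]) = v" using p(2) by (cases ps) (auto simp: split(1))
  ultimately show ?thesis using split by (intro that) auto
qed

lemma vpath_reroute:
  assumes G: "pair_graph G" and us: "vpath (A @ M @ B) (with_proj G)" "A \<noteq> []"
    and ps: "vpath (ps @ [last A]) (with_proj G)" "set ps \<inter> set (A @ M @ B) = {}"
    and jump: "B = [] \<or> (hd A, hd B) \<in> parcs G"
  shows "vpath (ps @ rev A @ B) (with_proj G)"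
proof -
  have "vpath A (with_proj G)"
    using us by (auto simp: vpath_iff_successively successively_append_iff)
  then have "vpath (rev A) (with_proj G)" by (rule vpath_rev[OF G])
  then show ?thesis
    using us ps jump
    by (auto simp: vpath_iff_successively successively_append_iff hd_rev last_rev
        simp del: successively_rev)
qed

section \<open>Splitting the neighbours of the centre of a broom\<close>

locale broom_host =
  fixes G :: ngraph and us :: "nat list" and L :: "nat set" and q :: nat
  assumes pair_graph_G: "pair_graph G" and copy: "broom_copy G us L"
    and length_us: "length us = Suc q"
begin

abbreviation E where "E \<equiv> parcs G"

definition path_nbrs :: "nat set" where "path_nbrs = nbrs G (hd us) \<inter> set us"

definition copy_nbrs :: "nat set" where "copy_nbrs = path_nbrs \<union> L"

definition trace :: "nat set \<Rightarrow> nat \<Rightarrow> nat set" where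
  "trace W y = {w\<in>W. (w, y) \<in> E}"

definition trace_class :: "nat set \<Rightarrow> nat set \<Rightarrow> nat set" where
  "trace_class W T = {y\<in>copy_nbrs - W. trace W y = T}"

definition splitting :: "nat set \<Rightarrow> bool" where
  "splitting W \<longleftrightarrow> W \<subseteq> path_nbrs \<and> (\<forall>T\<subseteq>W. card (trace_class W T) + card W \<le> q)"

lemma path: "vpath us (with_proj G)" "us \<noteq> []" "distinct us" "set us \<subseteq> pverts G"
  using copy by (auto simp: broom_copy_def vpath_iff_successively)

lemma leaves: "L \<subseteq> nbrs G (hd us)" "L \<inter> set us = {}" "L \<subseteq> pverts G" "finite L"
  using copy pair_graph_arcD(2)[OF pair_graph_G]
    finite_subset[OF _ pair_graph_finite(2)[OF pair_graph_G, of "hd us"]]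
  by (auto simp: broom_copy_def)

lemma path_nbrs_subset:
  "path_nbrs \<subseteq> set (tl us)" "path_nbrs \<subseteq> set us" "hd us \<notin> path_nbrs"
  "finite path_nbrs"
proof -
  show "hd us \<notin> path_nbrs" using pair_graph_arcD(3)[OF pair_graph_G] by (auto simp: path_nbrs_def)
  moreover have "set us = insert (hd us) (set (tl us))" using path(2) by (cases us) auto
  ultimately show "path_nbrs \<subseteq> set (tl us)" by (auto simp: path_nbrs_def)
qed (auto simp: path_nbrs_def)

lemma card_set_tl: "card (set (tl us)) = q"
  using path(3) length_us by (simp add: distinct_card distinct_tl)

lemma card_path_nbrs_le: "card path_nbrs \<le> q"
  using card_mono[OF _ path_nbrs_subset(1)] card_set_tl by simp

lemma copy_nbrs_facts:
  "finite copy_nbrs" "copy_nbrs \<subseteq> nbrs G (hd us)" "copy_nbrs \<subseteq> pverts G"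
  "card copy_nbrs = card path_nbrs + card L"
  using path_nbrs_subset leaves path(4) card_Un_disjoint[of path_nbrs L]
  by (auto simp: copy_nbrs_def path_nbrs_def)

lemma vpath_through_leaf:
  assumes ps: "vpath (ps @ [x]) (with_proj G)" "set ps \<inter> (set us \<union> L) = {}" and x: "x \<in> L"
  shows "vpath (ps @ x # us) (with_proj G)"
proof -
  have "(x, hd us) \<in> E" using x leaves(1) pair_graph_arcD(4)[OF pair_graph_G] by auto
  then show ?thesis
    using ps path(1) x leaves(2)
    by (auto simp: vpath_iff_successively successively_append_iff successively_Cons)
qed

end

text \<open>
  If no set splits, single vertices and small sets already show that every neighbour of the centre on
  the path is adjacent either to few elements of \<open>copy_nbrs\<close> (low) or to almost all of them, with fewer
  than \<open>excess\<close> deviations in total.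
\<close>

locale unsplittable_broom = broom_host +
  assumes few_leaves: "2 * card L \<le> q" and unsplittable: "\<And>W. \<not> splitting W"
begin

definition excess :: nat where "excess = card path_nbrs + card L - q"

definition low :: "nat \<Rightarrow> bool" where "low w \<longleftrightarrow> card {y\<in>copy_nbrs. (w, y) \<in> E} < excess"

definition deviates :: "nat \<Rightarrow> nat \<Rightarrow> bool" where "deviates w y \<longleftrightarrow> ((w, y) \<in> E \<longleftrightarrow> low w)"

lemma excess_eqs:
  "card path_nbrs + card L = q + excess" "card copy_nbrs = q + excess" "1 \<le> excess"
  "excess \<le> card L"
proof -
  have "\<not> card (trace_class {} {}) \<le> q" using unsplittable[of "{}"] by (simp add: splitting_def)
  then have "q < card copy_nbrs" by (simp add: trace_class_def trace_def)
  then show "card path_nbrs + card L = q + excess" "card copy_nbrs = q + excess" "1 \<le> excess"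
    "excess \<le> card L"
    using card_path_nbrs_le copy_nbrs_facts(4) by (auto simp: excess_def)
qed

lemma card_high_nonadjacent:
  assumes w: "w \<in> path_nbrs" and high: "\<not> low w"
  shows "card {y\<in>copy_nbrs - {w}. (w, y) \<notin> E} < excess"
proof -
  let ?A = "{y\<in>copy_nbrs. (w, y) \<in> E}" and ?B = "{y\<in>copy_nbrs - {w}. (w, y) \<notin> E}"
  have irrefl: "(w, w) \<notin> E" using pair_graph_arcD(3)[OF pair_graph_G] by blast
  have "copy_nbrs = insert w (?A \<union> ?B)" using w irrefl by (auto simp: copy_nbrs_def)
  then have "card copy_nbrs = card (insert w (?A \<union> ?B))" by simp
  also have "\<dots> = 1 + card (?A \<union> ?B)"
    using copy_nbrs_facts(1) irrefl by (subst card_insert_disjoint) auto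
  also have "card (?A \<union> ?B) = card ?A + card ?B"
    by (rule card_Un_disjoint) (use copy_nbrs_facts(1) in auto)
  finally have sum: "card ?A + card ?B + 1 = q + excess" using excess_eqs(2) by simp
  obtain T where T: "T = {} \<or> T = {w}" "q < card (trace_class {w} T) + 1"
    using unsplittable[of "{w}"] w by (auto simp: splitting_def not_le subset_singleton_iff)
  have "trace_class {w} {} = ?B" by (auto simp: trace_class_def trace_def)
  moreover have "trace_class {w} {w} = ?A" using irrefl by (auto simp: trace_class_def trace_def)
  ultimately have "q < card ?B + 1 \<or> q < card ?A + 1" using T by (elim disjE) simp_all
  then show ?thesis using sum high unfolding low_def by linarith
qed

lemma card_trace_class_less:
  assumes "w \<in> W" "W \<subseteq> path_nbrs" "w \<in> T \<longleftrightarrow> low w"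
  shows "card (trace_class W T) < excess"
proof -
  let ?X = "if low w then {y\<in>copy_nbrs. (w, y) \<in> E} else {y\<in>copy_nbrs - {w}. (w, y) \<notin> E}"
  have "trace_class W T \<subseteq> ?X" using assms by (auto simp: trace_class_def trace_def)
  then have "card (trace_class W T) \<le> card ?X" using copy_nbrs_facts(1) by (intro card_mono) auto
  also have "\<dots> < excess" using card_high_nonadjacent[of w] assms by (auto simp: low_def)
  finally show ?thesis .
qed

lemma card_deviating:
  assumes W: "W \<subseteq> path_nbrs"
  shows "card {y\<in>copy_nbrs - W. \<exists>w\<in>W. deviates w y} < excess"
proof (rule ccontr)
  assume "\<not> ?thesis"
  then have "excess \<le> card {y\<in>copy_nbrs - W. \<exists>w\<in>W. deviates w y}" by simp
  then obtain D where D: "D \<subseteq> {y\<in>copy_nbrs - W. \<exists>w\<in>W. deviates w y}" "card D = excess"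
    by (rule obtain_subset_with_card_n)
  have finD: "finite D" using D(1) copy_nbrs_facts(1) by (auto intro: finite_subset[of _ copy_nbrs])
  have "\<exists>f. \<forall>y\<in>D. f y \<in> W \<and> deviates (f y) y" using D(1) by (intro bchoice) auto
  then obtain f where f: "\<And>y. y \<in> D \<Longrightarrow> f y \<in> W \<and> deviates (f y) y" by blast
  define V where "V = f ` D"
  have V: "V \<subseteq> path_nbrs" "card V \<le> excess" "finite V" "V \<subseteq> copy_nbrs" "D \<subseteq> copy_nbrs - V"
    using f W D card_image_le[OF finD, of f] finD by (auto simp: V_def copy_nbrs_def)
  have "card (trace_class V T) + card V \<le> q" for T
  proof (cases "\<exists>w\<in>V. w \<in> T \<longleftrightarrow> low w")
    case True
    then have "card (trace_class V T) < excess" using card_trace_class_less V(1) by blast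
    then show ?thesis using V(2) excess_eqs(4) few_leaves by linarith
  next
    case False
    have "trace_class V T \<subseteq> copy_nbrs - V - D"
      using False f by (fastforce simp: trace_class_def trace_def V_def deviates_def)
    then have "card (trace_class V T) \<le> card (copy_nbrs - V - D)"
      using copy_nbrs_facts(1) by (intro card_mono) auto
    also have "\<dots> = q + excess - card V - excess"
      using V(3-5) finD D(2) excess_eqs(2) by (simp add: card_Diff_subset)
    finally show ?thesis using V(2) excess_eqs(4) few_leaves by linarith
  qed
  then show False using unsplittable[of V] V(1) by (simp add: splitting_def)
qed

definition adaptable_leaves :: "nat set" where
  "adaptable_leaves = {l\<in>L. \<forall>w\<in>path_nbrs. \<not> deviates w l}"

lemma card_adaptable_leaves: "card L < card adaptable_leaves + excess"
proof -
  have sub: "adaptable_leaves \<subseteq> L" by (auto simp: adaptable_leaves_def)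
  have "L - adaptable_leaves \<subseteq> {y\<in>copy_nbrs - path_nbrs. \<exists>w\<in>path_nbrs. deviates w y}"
    using leaves(2) path_nbrs_subset(2) by (auto simp: adaptable_leaves_def copy_nbrs_def)
  then have "card (L - adaptable_leaves) \<le> card {y\<in>copy_nbrs - path_nbrs. \<exists>w\<in>path_nbrs. deviates w y}"
    using copy_nbrs_facts(1) by (intro card_mono) auto
  also have "\<dots> < excess" by (rule card_deviating) simp
  finally show ?thesis
    using card_Diff_subset[OF finite_subset[OF sub leaves(4)] sub] by linarith
qed

lemma card_low_matching:
  assumes M: "M \<subseteq> E \<inter> path_nbrs \<times> path_nbrs" "disjoint_arcs M"
    and low: "\<And>x y. (x, y) \<in> M \<Longrightarrow> low x \<or> low y"
  shows "card M < excess"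
proof -
  define low_end where "low_end a = (if low (fst a) then fst a else snd a)" for a
  define other_end where "other_end a = (if low (fst a) then snd a else fst a)" for a
  have arc: "(low_end a, other_end a) \<in> E" "low (low_end a)" "low_end a \<in> path_nbrs"
    "other_end a \<in> path_nbrs"
    if "a \<in> M" for a
    using that M(1) low[of "fst a" "snd a"] pair_graph_arcD(4)[OF pair_graph_G]
    by (auto simp: low_end_def other_end_def)
  have apart: "other_end a \<noteq> low_end b" "other_end a = other_end b \<Longrightarrow> a = b"
    if "a \<in> M" "b \<in> M" for a b
  proof -
    have "a = b \<or> {fst a, snd a} \<inter> {fst b, snd b} = {}"
      using M(2) that by (auto simp: disjoint_arcs_def pairwise_def)
    moreover have "low_end a \<noteq> other_end a"
      using arc(1)[OF that(1)] pair_graph_arcD(3)[OF pair_graph_G] by blast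
    ultimately show "other_end a \<noteq> low_end b" "other_end a = other_end b \<Longrightarrow> a = b"
      by (auto simp: low_end_def other_end_def split: if_splits)
  qed
  let ?W = "low_end ` M"
  have "other_end ` M \<subseteq> {y\<in>copy_nbrs - ?W. \<exists>w\<in>?W. deviates w y}"
    using arc apart(1) by (fastforce simp: copy_nbrs_def deviates_def)
  then have "card (other_end ` M) \<le> card {y\<in>copy_nbrs - ?W. \<exists>w\<in>?W. deviates w y}"
    using copy_nbrs_facts(1) by (intro card_mono) auto
  also have "\<dots> < excess" by (rule card_deviating) (use arc(3) in auto)
  finally show ?thesis using apart(2) by (simp add: card_image inj_on_def)
qed

definition high :: "nat set" where "high = {w\<in>path_nbrs. \<not> low w}"

abbreviation nbr_pair :: "nat \<Rightarrow> nat \<Rightarrow> bool" where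
  "nbr_pair \<equiv> \<lambda>x y. x \<in> path_nbrs \<and> y \<in> path_nbrs"

abbreviation high_pair :: "nat \<Rightarrow> nat \<Rightarrow> bool" where
  "high_pair \<equiv> \<lambda>x y. x \<in> high \<and> y \<in> high"

abbreviation low_pair :: "nat \<Rightarrow> nat \<Rightarrow> bool" where
  "low_pair \<equiv> \<lambda>x y. nbr_pair x y \<and> \<not> high_pair x y"

text \<open>
  Every second arc of the path gives a matching, so each parity contributes fewer than \<open>excess\<close> arcs.
\<close>

lemma count_low_pairs: "count_successively low_pair us + 2 \<le> 2 * excess"
proof -
  have "length (filter (case_prod low_pair) (alternating_arcs xs)) < excess"
    if xs: "distinct xs" "set (vwalk_arcs xs) \<subseteq> E" for xs
  proof -
    let ?M = "set (filter (case_prod low_pair) (alternating_arcs xs))"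
    have "card ?M < excess"
    proof (rule card_low_matching)
      show "?M \<subseteq> E \<inter> path_nbrs \<times> path_nbrs" using xs(2) set_alternating_arcs_subset[of xs] by auto
      show "disjoint_arcs ?M"
        using disjoint_alternating_arcs[OF xs(1)]
        by (auto simp: disjoint_arcs_def intro: pairwise_subset)
    qed (auto simp: high_def)
    moreover have "distinct (filter (case_prod low_pair) (alternating_arcs xs))"
      using disjoint_alternating_arcs[OF xs(1)] by simp
    ultimately show ?thesis by (simp only: distinct_card)
  qed
  moreover have "set (vwalk_arcs us) \<subseteq> E" using path(1) by (auto simp: vpath_def vwalk_def)
  moreover from this have "set (vwalk_arcs (tl us)) \<subseteq> E"
    using set_vwalk_arcs_cons[of "tl us" "hd us"] path(2) by auto
  ultimately have "length (filter (case_prod low_pair) (alternating_arcs us)) < excess"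
    "length (filter (case_prod low_pair) (alternating_arcs (tl us))) < excess"
    using path(3) distinct_tl by blast+
  then show ?thesis unfolding count_successively_alternating[of low_pair us] by linarith
qed

lemma length_le_count_high_pairs:
  assumes us: "us = A @ M @ B" "A \<noteq> []" and M: "set M \<inter> path_nbrs = {}"
  shows "length M \<le> count_successively high_pair A + count_successively high_pair B"
proof -
  let ?P = "\<lambda>x. x \<in> path_nbrs"
  have tl: "tl us = tl A @ M @ B" using us by simp
  have "set (filter ?P (tl us)) = path_nbrs" using path_nbrs_subset(1) by auto
  then have "card path_nbrs = length (filter ?P (tl us))"
    using path(3) distinct_card[of "filter ?P (tl us)"] by (simp add: distinct_tl)
  moreover have "filter ?P M = []" using M by (auto simp: filter_empty_conv)
  ultimately have card_eq: "card path_nbrs = length (filter ?P (tl A)) + length (filter ?P B)"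
    by (simp add: tl)
  have "length (tl A) + length M + length B = q" using length_us us by (cases A) auto
  then have "2 * card path_nbrs + length M \<le>
      count_successively nbr_pair (tl A) + count_successively nbr_pair B + q + 2"
    using card_eq sum_length_filter_compl[of ?P "tl A"] sum_length_filter_compl[of ?P B]
      length_filter_le_count_successively[of ?P "tl A"] length_filter_le_count_successively[of ?P B]
    by linarith
  moreover have "count_successively nbr_pair (tl A) \<le> count_successively nbr_pair A"
    by (rule count_successively_tl_le)
  moreover have low: "count_successively nbr_pair xs =
      count_successively high_pair xs + count_successively low_pair xs" for xs
  proof -
    have "(\<lambda>x y. nbr_pair x y \<and> high_pair x y) = high_pair" by (auto simp: high_def fun_eq_iff)
    then show ?thesis using count_successively_split[of nbr_pair xs high_pair] by simp
  qed
  moreover have "count_successively low_pair A + count_successively low_pair B + 2 \<le> 2 * excess"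
    using count_low_pairs count_successively_append_le[of low_pair A "M @ B"]
      count_successively_append_le[of low_pair M B]
    unfolding us(1) by linarith
  ultimately show ?thesis using low[of A] low[of B] excess_eqs(1) few_leaves by linarith
qed

lemma high_adaptable_arc: "l \<in> adaptable_leaves \<Longrightarrow> s \<in> high \<Longrightarrow> (s, l) \<in> E"
  by (auto simp: adaptable_leaves_def high_def deviates_def)

lemma length_le_card_adaptable_leaves:
  assumes us: "us = A @ M @ B" "A \<noteq> []" and M: "set M \<inter> path_nbrs = {}"
  shows "length M \<le> card adaptable_leaves"
proof -
  have "tl us = tl A @ M @ B" using us by simp
  then have "set M \<subseteq> set (tl us) - path_nbrs" using M by auto
  moreover have "length M = card (set M)" using path(3) us(1) by (simp add: distinct_card)
  ultimately have "length M \<le> card (set (tl us) - path_nbrs)" by (simp add: card_mono)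
  also have "\<dots> = q - card path_nbrs"
    using path_nbrs_subset(1,4) card_set_tl by (simp add: card_Diff_subset)
  finally show ?thesis using card_adaptable_leaves excess_eqs(1,4) by linarith
qed

text \<open>
  The long path reaches the copy in \<open>last A\<close> and returns along \<open>A\<close> to the centre; from there it
  jumps to the next neighbour \<open>hd B\<close> of the centre. The vertices \<open>M\<close> that it misses are made up for by
  leaves.
\<close>

lemma ex_long_path_reaching_path:
  assumes us_eq: "us = A @ M @ B" "A \<noteq> []" and M: "set M \<inter> path_nbrs = {}"
    and jump: "B = [] \<or> hd B \<in> path_nbrs"
    and ps: "vpath (ps @ [last A]) (with_proj G)" "set ps \<inter> (set us \<union> L) = {}"
  obtains ys where "vpath ys (with_proj G)" "hd ys = hd (ps @ [last A])" "q < length ys"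
proof -
  define zs where "zs = ps @ rev A @ B"
  have "hd A = hd us" using us_eq by simp
  then have "B = [] \<or> (hd A, hd B) \<in> E" using jump by (auto simp: path_nbrs_def)
  then have zs: "vpath zs (with_proj G)"
    unfolding zs_def using path(1) ps us_eq
    by (intro vpath_reroute[OF pair_graph_G, where M = M]) auto
  have hd: "hd zs = hd (ps @ [last A])" using us_eq(2) by (cases ps) (auto simp: zs_def hd_rev)
  have "length M \<le> count_successively high_pair (rev A) + count_successively high_pair B"
    using length_le_count_high_pairs[OF us_eq M] by (subst count_successively_rev) auto
  also have "\<dots> \<le> count_successively high_pair (rev A @ B)"
    by (rule count_successively_append_le)
  also have "\<dots> \<le> count_successively high_pair zs"
    using count_successively_append_le[of high_pair ps "rev A @ B"] by (simp add: zs_def)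
  finally have places: "length M \<le> count_successively high_pair zs" .
  have "adaptable_leaves \<subseteq> L" by (auto simp: adaptable_leaves_def)
  moreover have "L \<inter> set zs = {}" using ps(2) leaves(2) us_eq(1) by (auto simp: zs_def)
  ultimately have "adaptable_leaves \<subseteq> pverts G" "adaptable_leaves \<inter> set zs = {}"
    using leaves(3) by auto
  then obtain ys where ys: "vpath ys (with_proj G)" "hd ys = hd zs"
    "length ys = length zs + length M"
    using vpath_insert_between[OF pair_graph_G zs _ _ high_adaptable_arc places
        length_le_card_adaptable_leaves[OF us_eq M]] by blast
  moreover have "length A + length M + length B = Suc q" using length_us us_eq(1) by simp
  ultimately show ?thesis using hd by (intro that[of ys]) (auto simp: zs_def)
qed

lemma ex_long_path:
  assumes "connected_graph G" "v \<in> pverts G"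
  obtains ys where "vpath ys (with_proj G)" "hd ys = v" "q < length ys"
proof -
  have "hd us \<in> set us \<union> L" "hd us \<in> pverts G" using path(2,4) by auto
  then obtain ps x where ps: "vpath (ps @ [x]) (with_proj G)" "hd (ps @ [x]) = v"
    and x: "x \<in> set us \<union> L" "set ps \<inter> (set us \<union> L) = {}"
    by (rule vpath_to_set[OF assms])
  show ?thesis
  proof (cases "x \<in> L")
    case True
    have "hd (ps @ x # us) = v" using ps(2) by (cases ps) auto
    then show ?thesis
      using length_us by (intro that[OF vpath_through_leaf[OF ps(1) x(2) True]]) auto
  next
    case False
    then obtain A R where split: "us = A @ x # R" using x(1) by (meson UnE split_list)
    define M B where "M = takeWhile (\<lambda>y. y \<notin> path_nbrs) R"
      and "B = dropWhile (\<lambda>y. y \<notin> path_nbrs) R"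
    have "us = (A @ [x]) @ M @ B" by (simp add: split M_def B_def)
    moreover have "set M \<inter> path_nbrs = {}" by (auto simp: M_def dest: set_takeWhileD)
    moreover have "B = [] \<or> hd B \<in> path_nbrs"
      using hd_dropWhile[of "\<lambda>y. y \<notin> path_nbrs" R] unfolding B_def by blast
    ultimately obtain ys where "vpath ys (with_proj G)" "hd ys = hd (ps @ [x])" "q < length ys"
      using ex_long_path_reaching_path[of "A @ [x]" M B ps] ps(1) x(2) by auto
    then show ?thesis using ps(2) by (intro that) auto
  qed
qed

end

lemma (in broom_host) ex_splitting:
  assumes "connected_graph G" "2 * card L \<le> q" "v \<in> pverts G"
    and no_path: "\<nexists>ys. vpath ys (with_proj G) \<and> hd ys = v \<and> length ys = Suc q"
  obtains W where "splitting W"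
proof -
  have "\<exists>W. splitting W"
  proof (rule ccontr)
    assume "\<nexists>W. splitting W"
    then interpret unsplittable_broom G us L q using assms(2) by unfold_locales blast+
    obtain ys where ys: "vpath ys (with_proj G)" "hd ys = v" "q < length ys"
      by (rule ex_long_path[OF assms(1,3)])
    have "vpath (take (Suc q) ys) (with_proj G)" by (rule vpath_take[OF ys(1)]) simp
    moreover have "hd (take (Suc q) ys) = v" "length (take (Suc q) ys) = Suc q"
      using ys(2,3) by auto
    ultimately show False using no_path by blast
  qed
  then show ?thesis using that by blast
qed

section \<open>Transfer of brooms\<close>

definition broom :: "nat \<Rightarrow> nat \<Rightarrow> ngraph" where
  "broom q l = mk_graph (Suc q + l) (\<lambda>i j. j = Suc i \<and> j \<le> q \<or> i = 0 \<and> q < j)"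

lemma pair_graph_broom: "pair_graph (broom q l)"
  by (simp add: broom_def)

lemma v_count_broom: "v_count (broom q l) = Suc q + l"
  by (simp add: broom_def)

lemma connected_broom: "connected_graph (broom q l)"
  unfolding broom_def
proof (rule connected_mk_graph)
  fix i :: nat assume "0 < i"
  then show "\<exists>j<i. (j = Suc i \<and> j \<le> q \<or> i = 0 \<and> q < j) \<or> (i = Suc j \<and> i \<le> q \<or> j = 0 \<and> q < i)"
    by (intro exI[of _ "if i \<le> q then i - 1 else 0"]) auto
qed simp

lemma is_broom_broom: "is_broom (broom q l) [0..<Suc q] {q<..<Suc q + l}"
proof -
  have "vpath [0..<Suc q] (with_proj (broom q l))"
    by (auto simp: vpath_iff_successively successively_conv_nth broom_def simp del: upt_Suc)
  moreover have "(i, Suc i) \<in> set (vwalk_arcs [0..<Suc q])" if "i < q" for i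
    using vwalk_arcs_nthI[of i "[0..<Suc q]"] that by (simp del: upt_Suc)
  then have "parcs (broom q l) \<subseteq> broom_arcs [0..<Suc q] {q<..<Suc q + l}"
    by (auto simp: broom_def broom_arcs_def mk_graph_def simp del: upt_Suc)
  ultimately show ?thesis
    by (auto simp: is_broom_def broom_copy_def broom_def simp del: upt_Suc)
qed

lemma containing_broom_iff:
  assumes "pair_graph G"
  shows "G \<in> containing (broom q l) \<longleftrightarrow>
    (\<exists>us L. broom_copy G us L \<and> length us = Suc q \<and> l \<le> card L)"
  using containing_is_broom_iff[OF pair_graph_broom is_broom_broom assms] by (simp del: upt_Suc)

lemma card_le_by_fibres:
  assumes "finite A" "finite B"
    and fibres: "\<And>t. t \<in> f ` A \<Longrightarrow> card {a\<in>A. f a = t} \<le> card {b\<in>B. g b = t}"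
  shows "card A \<le> card B"
proof -
  have "card A = (\<Sum>t\<in>f ` A. card {a\<in>A. f a = t})"
    using sum.group[of A "f ` A" f "\<lambda>_. 1 :: nat"] assms(1) by simp
  also have "\<dots> \<le> (\<Sum>t\<in>f ` A. card {b\<in>B. g b = t})" by (rule sum_mono) (rule fibres)
  also have "\<dots> = card (\<Union>t\<in>f ` A. {b\<in>B. g b = t})"
    using assms(1,2) by (intro card_UN_disjoint[symmetric]) auto
  also have "\<dots> \<le> card B" using assms(2) by (intro card_mono) auto
  finally show ?thesis .
qed

locale pebbled_broom = broom_host +
  fixes H :: ngraph and W :: "nat set" and \<phi> :: "nat \<Rightarrow> nat"
  assumes H: "pair_graph H" and W: "W \<subseteq> path_nbrs" and \<phi>: "partial_iso G H (set us) \<phi>"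
    and class_iso: "\<And>T. T \<subseteq> W \<Longrightarrow> \<exists>\<sigma>. partial_iso G H (insert (hd us) W \<union> trace_class W T) \<sigma> \<and>
      (\<forall>x\<in>insert (hd us) W. \<sigma> x = \<phi> x)"
begin

definition trace_image :: "nat \<Rightarrow> nat set" where
  "trace_image y = {w\<in>W. (\<phi> w, y) \<in> parcs H}"

definition class_image :: "nat set \<Rightarrow> nat set" where
  "class_image T = {y\<in>nbrs H (\<phi> (hd us)) - \<phi> ` W. trace_image y = T}"

lemma finite_class_image: "finite (class_image T)"
  by (rule finite_subset[OF _ pair_graph_finite(2)[OF H, of "\<phi> (hd us)"]]) (auto simp: class_image_def)

lemma card_trace_class_le:
  assumes "T \<subseteq> W"
  shows "card (trace_class W T) \<le> card (class_image T)"
proof -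
  obtain \<sigma> where \<sigma>: "partial_iso G H (insert (hd us) W \<union> trace_class W T) \<sigma>"
    and same: "\<sigma> (hd us) = \<phi> (hd us)" "\<And>w. w \<in> W \<Longrightarrow> \<sigma> w = \<phi> w"
    using class_iso[OF assms] by auto
  have "\<sigma> y \<in> class_image T" if y: "y \<in> trace_class W T" for y
  proof -
    have y': "(hd us, y) \<in> E" "y \<notin> W" using y copy_nbrs_facts(2) by (auto simp: trace_class_def)
    have arc: "(\<phi> x, \<sigma> y) \<in> parcs H \<longleftrightarrow> (x, y) \<in> E" if "x \<in> insert (hd us) W" for x
      using partial_iso_arc_iff[OF \<sigma>, of x y] same that y by auto
    have "\<sigma> y \<notin> \<sigma> ` W" using \<sigma> y y'(2) by (auto simp: partial_iso_def inj_on_def)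
    then have "\<sigma> y \<notin> \<phi> ` W" using same(2) by auto
    moreover have "trace_image (\<sigma> y) = T"
      using arc y by (auto simp: trace_image_def trace_class_def trace_def)
    ultimately show ?thesis using arc y'(1) by (auto simp: class_image_def)
  qed
  moreover have "inj_on \<sigma> (trace_class W T)"
    using \<sigma> by (auto simp: partial_iso_def intro: inj_on_subset)
  ultimately show ?thesis by (intro card_inj_on_le[OF _ _ finite_class_image]) auto
qed

lemma class_image_on_path: "class_image T \<inter> \<phi> ` set us \<subseteq> \<phi> ` (trace_class W T \<inter> set us)"
proof
  fix z assume z: "z \<in> class_image T \<inter> \<phi> ` set us"
  then obtain y where y: "y \<in> set us" "z = \<phi> y" by blast
  have arc: "(\<phi> x, \<phi> y) \<in> parcs H \<longleftrightarrow> (x, y) \<in> E" if "x \<in> insert (hd us) W" for x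
    using partial_iso_arc_iff[OF \<phi>, of x y] that y(1) W path_nbrs_subset(2) path(2) by auto
  have "(hd us, y) \<in> E" using arc z y(2) by (auto simp: class_image_def)
  moreover have "y \<notin> W" using z y by (auto simp: class_image_def)
  moreover have "trace W y = T"
    using arc z y(2) by (auto simp: trace_def class_image_def trace_image_def)
  ultimately have "y \<in> trace_class W T"
    using y(1) by (auto simp: trace_class_def copy_nbrs_def path_nbrs_def)
  then show "z \<in> \<phi> ` (trace_class W T \<inter> set us)" using y by blast
qed

lemma card_leaf_class_le:
  assumes "T \<subseteq> W"
  shows "card (trace_class W T \<inter> L) \<le> card (class_image T - \<phi> ` set us)"
proof -
  have fin: "finite (trace_class W T)" using copy_nbrs_facts(1) by (simp add: trace_class_def)
  have "card (class_image T \<inter> \<phi> ` set us) \<le> card (\<phi> ` (trace_class W T \<inter> set us))"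
    by (rule card_mono[OF _ class_image_on_path]) simp
  also have "\<dots> \<le> card (trace_class W T \<inter> set us)" by (rule card_image_le) simp
  finally have "card (class_image T \<inter> \<phi> ` set us) \<le> card (trace_class W T \<inter> set us)" .
  moreover have "trace_class W T = (trace_class W T \<inter> L) \<union> (trace_class W T \<inter> set us)"
    using path_nbrs_subset(2) by (auto simp: trace_class_def copy_nbrs_def)
  then have "card (trace_class W T) = card (trace_class W T \<inter> L) + card (trace_class W T \<inter> set us)"
    using card_Un_disjoint[of "trace_class W T \<inter> L" "trace_class W T \<inter> set us"] fin leaves(2)
    by auto
  moreover have "card (class_image T) =
      card (class_image T \<inter> \<phi> ` set us) + card (class_image T - \<phi> ` set us)"
    by (rule card_Int_Diff[OF finite_class_image])
  ultimately show ?thesis using card_trace_class_le[OF assms] by linarith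
qed

lemma containing_broom: "H \<in> containing (broom q (card L))"
proof -
  define L' where "L' = nbrs H (\<phi> (hd us)) - \<phi> ` set us"
  have L_W: "L \<inter> W = {}" using leaves(2) W path_nbrs_subset(2) by auto
  have "card L \<le> card L'"
  proof (rule card_le_by_fibres[OF leaves(4)])
    show "finite L'" using pair_graph_finite(2)[OF H] by (simp add: L'_def)
    fix T assume "T \<in> trace W ` L"
    then have "T \<subseteq> W" by (auto simp: trace_def)
    moreover have "{y\<in>L. trace W y = T} = trace_class W T \<inter> L"
      using L_W by (auto simp: trace_class_def copy_nbrs_def)
    moreover have "{y\<in>L'. trace_image y = T} = class_image T - \<phi> ` set us"
      using W path_nbrs_subset(2) by (auto simp: class_image_def L'_def)
    ultimately show "card {y\<in>L. trace W y = T} \<le> card {y\<in>L'. trace_image y = T}"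
      using card_leaf_class_le by simp
  qed
  moreover have "broom_copy H (map \<phi> us) L'"
    using vpath_partial_iso[OF \<phi> path(1)] path(2) by (auto simp: broom_copy_def L'_def hd_map)
  ultimately show ?thesis
    using containing_broom_iff[OF H] length_us by (metis length_map)
qed

end

lemma (in broom_host) splitting_transfer:
  assumes W: "splitting W" and H: "pair_graph H" and game: "duplicator_wins G H (Suc q) {} \<tau>\<^sub>0"
  shows "H \<in> containing (broom q (card L))"
proof -
  have WP: "W \<subseteq> path_nbrs" and classes: "\<And>T. T \<subseteq> W \<Longrightarrow> card (trace_class W T) + card W \<le> q"
    using W by (auto simp: splitting_def)
  have finW: "finite W" using finite_subset[OF WP path_nbrs_subset(4)] .
  have hd: "hd us \<notin> W" using WP path_nbrs_subset(3) by blast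
  have cardW: "card W \<le> q" using card_mono[OF path_nbrs_subset(4) WP] card_path_nbrs_le by simp
  let ?X = "insert (hd us) W"
  have X: "finite ?X" "?X \<subseteq> set us" "card ?X = Suc (card W)"
    using finW hd WP path_nbrs_subset(2) path(2) by auto
  obtain \<tau> where "duplicator_wins G H (Suc q - card ?X) ({} \<union> ?X) \<tau>"
    by (rule duplicator_wins_extend[OF game X(1)]) (use X path(4) cardW in auto)
  then have \<tau>: "duplicator_wins G H (q - card W) ?X \<tau>" using X(3) by simp
  have extend: "\<exists>\<sigma>. partial_iso G H (?X \<union> Y) \<sigma> \<and> (\<forall>x\<in>?X. \<sigma> x = \<tau> x)"
    if "finite Y" "Y \<subseteq> pverts G" "?X \<inter> Y = {}" "card Y + card W \<le> q" for Y
    by (rule duplicator_wins_partial_iso_extend[OF \<tau> that(1-3)]) (use that(4) in auto)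
  have union: "?X \<union> (set us - ?X) = set us" using X(2) by auto
  have "card (set us - ?X) = q - card W"
    using X card_Diff_subset[OF X(1,2)] length_us path(3) by (simp add: distinct_card)
  then have "\<exists>\<sigma>. partial_iso G H (?X \<union> (set us - ?X)) \<sigma> \<and> (\<forall>x\<in>?X. \<sigma> x = \<tau> x)"
    using path(4) cardW by (intro extend) auto
  then obtain \<phi> where \<phi>: "partial_iso G H (set us) \<phi>" "\<forall>x\<in>?X. \<phi> x = \<tau> x"
    unfolding union by blast
  interpret pebbled_broom G us L q H W \<phi>
  proof (intro pebbled_broom.intro pebbled_broom_axioms.intro)
    fix T assume "T \<subseteq> W"
    moreover have "?X \<inter> trace_class W T = {}"
      using copy_nbrs_facts(2) pair_graph_arcD(3)[OF pair_graph_G] by (auto simp: trace_class_def)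
    moreover have "finite (trace_class W T)" "trace_class W T \<subseteq> pverts G"
      using copy_nbrs_facts(1,3) by (auto simp: trace_class_def)
    ultimately have "\<exists>\<sigma>. partial_iso G H (?X \<union> trace_class W T) \<sigma> \<and> (\<forall>x\<in>?X. \<sigma> x = \<tau> x)"
      using classes by (intro extend) auto
    then show "\<exists>\<sigma>. partial_iso G H (?X \<union> trace_class W T) \<sigma> \<and> (\<forall>x\<in>?X. \<sigma> x = \<phi> x)"
      using \<phi>(2) by simp
  qed (use broom_host_axioms H WP \<phi>(1) in auto)
  show ?thesis by (rule containing_broom)
qed

section \<open>Brooms in large connected graphs\<close>

lemma card_relpow_Image_le:
  fixes R :: "'a rel"
  assumes fin: "\<And>x. finite (R `` {x})" and card: "\<And>x. card (R `` {x}) \<le> D"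
  shows "finite ((R ^^ k) `` {x}) \<and> card ((R ^^ k) `` {x}) \<le> D ^ k"
proof (induction k)
  case (Suc k)
  have step: "(R ^^ Suc k) `` {x} = (\<Union>y\<in>(R ^^ k) `` {x}. R `` {y})" by auto
  have "card ((R ^^ Suc k) `` {x}) \<le> (\<Sum>y\<in>(R ^^ k) `` {x}. card (R `` {y}))"
    unfolding step by (rule card_UN_le) (use Suc in blast)
  also have "\<dots> \<le> (\<Sum>y\<in>(R ^^ k) `` {x}. D)" by (rule sum_mono) (rule card)
  also have "\<dots> \<le> D ^ Suc k" using Suc by simp
  finally show ?case using Suc fin unfolding step by blast
qed simp

lemma successively_imp_reflcl_relpow:
  "successively (\<lambda>x y. (x, y) \<in> R) xs \<Longrightarrow> xs \<noteq> [] \<Longrightarrow> length xs \<le> Suc k \<Longrightarrow>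
    (hd xs, last xs) \<in> (R\<^sup>=) ^^ k"
proof (induction k arbitrary: xs)
  case 0
  then show ?case by (cases xs) auto
next
  case (Suc k)
  then obtain x ys where xs: "xs = x # ys" by (cases xs) auto
  show ?case
  proof (cases "ys = []")
    case True
    then have "(x, x) \<in> (R\<^sup>=) ^^ k" using Suc.IH[of "[x]"] by simp
    then have "(x, x) \<in> (R\<^sup>=) ^^ Suc k" by (rule relpow_Suc_I) simp
    then show ?thesis using True xs by simp
  next
    case False
    then have "(x, hd ys) \<in> R\<^sup>=" "(hd ys, last ys) \<in> (R\<^sup>=) ^^ k"
      using Suc xs by (auto simp: successively_Cons)
    then have "(x, last ys) \<in> (R\<^sup>=) ^^ Suc k" by (rule relpow_Suc_I2)
    then show ?thesis using False xs by simp
  qed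
qed

lemma ex_far_vertex:
  assumes G: "pair_graph G" and degree: "\<And>z. card (nbrs G z) < D"
    and large: "D ^ k < card (pverts G)"
  obtains y where "y \<in> pverts G" "(x, y) \<notin> ((parcs G)\<^sup>=) ^^ k"
proof -
  have "(parcs G)\<^sup>= `` {z} = insert z (nbrs G z)" for z by auto
  then have "finite ((parcs G)\<^sup>= `` {z})" "card ((parcs G)\<^sup>= `` {z}) \<le> D" for z
    using pair_graph_finite(2)[OF G, of z] degree[of z] by (simp_all add: card_insert_if)
  then have "finite ((((parcs G)\<^sup>=) ^^ k) `` {x})" "card ((((parcs G)\<^sup>=) ^^ k) `` {x}) \<le> D ^ k"
    using card_relpow_Image_le[of "(parcs G)\<^sup>="] by blast+
  then have "\<not> pverts G \<subseteq> (((parcs G)\<^sup>=) ^^ k) `` {x}"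
    using large card_mono[of "(((parcs G)\<^sup>=) ^^ k) `` {x}" "pverts G"] by auto
  then show ?thesis using that by blast
qed

lemma vpath_shortcut:
  fixes G :: "'a pair_pre_digraph"
  assumes us: "vpath us (with_proj G)" and i: "0 < i" "i < length us"
    and arc: "(hd us, us ! i) \<in> parcs G"
  shows "vpath (hd us # drop i us) (with_proj G)"
proof -
  have "us = take i us @ drop i us" "hd (drop i us) = us ! i"
    using i by (simp_all add: hd_drop_conv_nth)
  moreover have "hd us \<in> set (take i us)" using i by (cases us; cases i) auto
  moreover have "set (take i us) \<inter> set (drop i us) = {}"
    using us by (intro set_take_disj_set_drop_if_distinct) (auto simp: vpath_iff_successively)
  ultimately show ?thesis
    using us i arc set_drop_subset[of i us] successively_append_iff[of _ "take i us" "drop i us"]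
    by (auto simp: vpath_iff_successively successively_Cons)
qed

lemma ex_long_shortest_path:
  assumes connected: "connected_graph G" and degree: "\<And>z. card (nbrs G z) < D"
    and large: "D ^ k < v_count G" and x: "x \<in> pverts G"
  obtains us where "vpath us (with_proj G)" "hd us = x" "Suc k < length us"
    "nbrs G x \<inter> set us \<subseteq> {us ! 1}"
proof -
  have G: "pair_graph G" using connected by (rule connected_graph_pair_graph)
  interpret pair_graph G by (rule G)
  obtain y where y: "y \<in> pverts G" "(x, y) \<notin> ((parcs G)\<^sup>=) ^^ k"
    by (rule ex_far_vertex[OF G degree large])
  let ?path = "\<lambda>us. vpath us (with_proj G) \<and> hd us = x \<and> last us = y"
  have "\<exists>us. ?path us"
    using connected_graph_reachable[OF connected x y(1)] reachable_vpath_conv by blast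
  then obtain us where us: "?path us" and shortest: "\<And>vs. ?path vs \<Longrightarrow> length us \<le> length vs"
    using ex_has_least_nat[of ?path _ length] by blast
  have walk: "successively (\<lambda>u v. (u, v) \<in> parcs G) us" "us \<noteq> []"
    using us by (auto simp: vpath_iff_successively)
  have "Suc k < length us"
    using successively_imp_reflcl_relpow[OF walk, of k] us y(2) by (metis not_less)
  moreover have "z = us ! 1" if z: "z \<in> nbrs G x" "z \<in> set us" for z
  proof -
    obtain i where i: "i < length us" "z = us ! i" using z(2) by (metis in_set_conv_nth)
    have "?path (x # drop i us)" if "0 < i" using vpath_shortcut[of us G i] that us z(1) i by auto
    from shortest[OF this] have "i \<le> 1" using i(1) by (cases i) auto
    moreover have "i \<noteq> 0"
    proof
      assume "i = 0"
      then have "z = x" using i(2) us walk(2) by (simp add: hd_conv_nth)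
      then show False using z(1) pair_graph_arcD(3)[OF G] by blast
    qed
    ultimately show ?thesis using i(2) by (simp add: le_Suc_eq)
  qed
  ultimately show ?thesis using us by (intro that[of us]) auto
qed

lemma containing_broom_if_paths_everywhere:
  assumes G: "connected_graph G" and large: "(Suc q + l) ^ q < v_count G"
    and paths: "\<And>v. v \<in> pverts G \<Longrightarrow> \<exists>ys. vpath ys (with_proj G) \<and> hd ys = v \<and> length ys = Suc q"
    and x: "x \<in> pverts G" "l < card (nbrs G x)"
  shows "G \<in> containing (broom q l)"
proof -
  have pG: "pair_graph G" using G by (rule connected_graph_pair_graph)
  have copy: "G \<in> containing (broom q l)"
    if "vpath us (with_proj G)" "length us = Suc q" "l \<le> card (nbrs G (hd us) - set us)" for us
    using that unfolding containing_broom_iff[OF pG] broom_copy_def by blast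
  show ?thesis
  proof (cases "\<exists>z. Suc q + l \<le> card (nbrs G z)")
    case True
    then obtain z where z: "Suc q + l \<le> card (nbrs G z)" by blast
    then have "nbrs G z \<noteq> {}" by auto
    then have "z \<in> pverts G" using pair_graph_arcD(1)[OF pG] by auto
    then obtain ys where ys: "vpath ys (with_proj G)" "hd ys = z" "length ys = Suc q"
      using paths by blast
    have "card (nbrs G z) - card (set ys) \<le> card (nbrs G z - set ys)"
      by (rule diff_card_le_card_Diff) simp
    then show ?thesis using copy[OF ys(1,3)] ys z card_length[of ys] by simp
  next
    case False
    then have "card (nbrs G z) < Suc q + l" for z by (simp add: not_le)
    then obtain us where us: "vpath us (with_proj G)" "hd us = x" "Suc q < length us"
      "nbrs G x \<inter> set us \<subseteq> {us ! 1}"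
      using ex_long_shortest_path[OF G _ large x(1)] by blast
    have "nbrs G x - {us ! 1} \<subseteq> nbrs G x - set (take (Suc q) us)"
      using us(4) set_take_subset[of "Suc q" us] by blast
    then have "card (nbrs G x - {us ! 1}) \<le> card (nbrs G x - set (take (Suc q) us))"
      using pair_graph_finite(2)[OF pG] by (intro card_mono) auto
    moreover have "card (nbrs G x) - card {us ! 1} \<le> card (nbrs G x - {us ! 1})"
      by (rule diff_card_le_card_Diff) simp
    ultimately have "l \<le> card (nbrs G x - set (take (Suc q) us))" using x(2) by simp
    then show ?thesis using copy[of "take (Suc q) us"] vpath_take[OF us(1)] us(2,3) by simp
  qed
qed

section \<open>Upper bound on the depth\<close>

lemma duplicator_wins_card_nbrs:
  assumes game: "duplicator_wins G H d {} \<tau>" and G: "pair_graph G" and H: "pair_graph H"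
    and v: "v \<in> pverts G" and Y: "Y \<subseteq> nbrs G v" "card Y < d"
  obtains v' where "v' \<in> pverts H" "card Y \<le> card (nbrs H v')"
proof -
  have Y': "finite Y" "Y \<subseteq> pverts G" "v \<notin> Y"
    using Y(1) finite_subset[OF Y(1) pair_graph_finite(2)[OF G]] pair_graph_arcD(2)[OF G]
      pair_graph_arcD(3)[OF G, of v v] by auto
  obtain \<sigma> where "duplicator_wins G H (d - card (insert v Y)) ({} \<union> insert v Y) \<sigma>"
    by (rule duplicator_wins_extend[OF game, of "insert v Y"]) (use v Y(2) Y' in auto)
  then have \<sigma>: "partial_iso G H (insert v Y) \<sigma>" by (simp add: duplicator_wins_partial_iso)
  have "\<sigma> ` Y \<subseteq> nbrs H (\<sigma> v)" using partial_iso_arc_iff[OF \<sigma>] Y(1) by auto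
  then have "card (\<sigma> ` Y) \<le> card (nbrs H (\<sigma> v))" by (rule card_mono[OF pair_graph_finite(2)[OF H]])
  moreover have "card (\<sigma> ` Y) = card Y"
    using \<sigma> by (auto simp: partial_iso_def intro: card_image inj_on_subset)
  ultimately show ?thesis using that[of "\<sigma> v"] \<sigma> by (auto simp: partial_iso_def)
qed

lemma duplicator_wins_paths:
  assumes game: "duplicator_wins G H (Suc q) {} \<tau>"
    and paths: "\<And>v. v \<in> pverts G \<Longrightarrow> \<exists>ys. vpath ys (with_proj G) \<and> hd ys = v \<and> length ys = Suc q"
    and v: "v \<in> pverts H"
  shows "\<exists>ys. vpath ys (with_proj H) \<and> hd ys = v \<and> length ys = Suc q"
proof -
  obtain a where a: "a \<in> pverts G" "duplicator_wins G H q {a} (\<tau>(a := v))" using game v by auto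
  obtain ys where "vpath ys (with_proj G)" "hd ys = a" "length ys = Suc q"
    using paths[OF a(1)] by blast
  then obtain zs where zs: "vpath (a # zs) (with_proj G)" "length zs = q" by (cases ys) auto
  have "set zs \<subseteq> pverts G" "{a} \<inter> set zs = {}" "card (set zs) = q"
    using zs by (auto simp: vpath_iff_successively distinct_card)
  then obtain \<sigma> where \<sigma>: "duplicator_wins G H (q - q) ({a} \<union> set zs) \<sigma>" "\<sigma> a = (\<tau>(a := v)) a"
    using duplicator_wins_extend[OF a(2), of "set zs"] by auto
  have "vpath (map \<sigma> (a # zs)) (with_proj H)"
    by (rule vpath_partial_iso[OF duplicator_wins_partial_iso[OF \<sigma>(1)] zs(1)]) simp
  then show ?thesis using \<sigma>(2) zs(2) by (intro exI[of _ "map \<sigma> (a # zs)"]) simp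
qed

lemma containing_broom_transfer_if_paths_everywhere:
  fixes G H :: ngraph
  assumes G: "pair_graph G" and H: "connected_graph H" and large: "(Suc q + card L) ^ q < v_count H"
    and game: "duplicator_wins G H (Suc q) {} \<tau>"
    and us: "broom_copy G us L" "length us = Suc q" "card L < q"
    and paths: "\<And>v. v \<in> pverts G \<Longrightarrow> \<exists>ys. vpath ys (with_proj G) \<and> hd ys = v \<and> length ys = Suc q"
  shows "H \<in> containing (broom q (card L))"
proof -
  interpret broom_host G us L q by (rule broom_host.intro) (use G us in auto)
  have "us ! 1 \<in> nbrs G (hd us) \<inter> set us"
    using path(1,2) vwalk_arcs_nthI[of 0 us] us(2,3) nth_mem[of 1 us]
    by (auto simp: vpath_def vwalk_def hd_conv_nth)
  then have "insert (us ! 1) L \<subseteq> nbrs G (hd us)" "card (insert (us ! 1) L) = Suc (card L)"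
    using leaves by (auto simp: card_insert_if)
  moreover have "hd us \<in> pverts G" using path(2,4) by auto
  ultimately obtain x where "x \<in> pverts H" "Suc (card L) \<le> card (nbrs H x)"
    using duplicator_wins_card_nbrs[OF game G connected_graph_pair_graph[OF H],
        of "hd us" "insert (us ! 1) L"] us(3) by auto
  then show ?thesis
    using containing_broom_if_paths_everywhere[OF H large duplicator_wins_paths[OF game paths]]
    by simp
qed

lemma containing_broom_game_invariant:
  assumes connected: "connected_graph G" and H: "connected_graph H" and q: "1 \<le> q" "2 * l \<le> q"
    and large: "(Suc q + l) ^ q < v_count H" and game: "duplicator_wins G H (Suc q) {} \<tau>"
    and containing: "G \<in> containing (broom q l)"
  shows "H \<in> containing (broom q l)"
proof -
  have G: "pair_graph G" using connected by (rule connected_graph_pair_graph)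
  obtain us L' where us: "broom_copy G us L'" "length us = Suc q" "l \<le> card L'"
    using containing containing_broom_iff[OF G] by blast
  obtain L where L: "L \<subseteq> L'" "card L = l" using us(3) by (rule obtain_subset_with_card_n)
  have copy: "broom_copy G us L" using us(1) L(1) by (auto simp: broom_copy_def)
  show ?thesis
  proof (cases "\<forall>v\<in>pverts G. \<exists>ys. vpath ys (with_proj G) \<and> hd ys = v \<and> length ys = Suc q")
    case True
    then have "H \<in> containing (broom q (card L))"
      using large q L(2)
      by (intro containing_broom_transfer_if_paths_everywhere[OF G H _ game copy us(2)]) auto
    then show ?thesis using L(2) by simp
  next
    case False
    then obtain v where v: "v \<in> pverts G"
      "\<nexists>ys. vpath ys (with_proj G) \<and> hd ys = v \<and> length ys = Suc q" by blast
    interpret broom_host G us L q by (rule broom_host.intro) (use G copy us(2) in auto)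
    obtain W where "splitting W" by (rule ex_splitting[OF connected _ v]) (use q(2) L(2) in auto)
    then show ?thesis
      using splitting_transfer[OF _ connected_graph_pair_graph[OF H] game] L(2) by blast
  qed
qed

lemma D'_broom_le:
  assumes q: "1 \<le> q" "2 * l \<le> q"
  shows "D' (broom q l) \<le> Suc q"
proof -
  define large where "large G \<longleftrightarrow> connected_graph G \<and> (Suc q + l) ^ q < v_count G" for G
  have invariant: "H \<in> containing (broom q l)"
    if "large G" "large H" "duplicator_wins G H (Suc q) {} \<tau>" "G \<in> containing (broom q l)" for G H \<tau>
    using containing_broom_game_invariant[OF _ _ q] that by (auto simp: large_def)
  obtain p where p: "sentence p" "qdepth p \<le> Suc q"
    "\<And>G. large G \<Longrightarrow> models G p \<longleftrightarrow> G \<in> containing (broom q l)"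
  proof (rule game_invariant_definable[of "Suc q" large "containing (broom q l)"])
    show "pverts G \<noteq> {}" if "large G" for G using that by (auto simp: large_def)
  qed (use invariant in auto)
  have "defines_asymptotically p (containing (broom q l))"
    unfolding defines_asymptotically_def
    using p(1,3) by (auto simp: large_def Suc_le_eq intro!: exI[of _ "Suc ((Suc q + l) ^ q)"])
  then have "D' (broom q l) \<le> qdepth p" unfolding D'_def by (intro Least_le) blast
  then show ?thesis using p(2) by simp
qed

lemma graph_iso_v_count:
  assumes "graph_iso F F'"
  shows "v_count F = v_count F'"
proof -
  obtain h where h: "pre_digraph.digraph_isomorphism (with_proj F) h"
    "with_proj F' = app_iso h (with_proj F)"
    using assms unfolding graph_iso_def digraph_iso_def by blast
  have "pverts F' = iso_verts h ` pverts F"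
    using arg_cong[OF h(2), of verts] by (simp add: app_iso_def)
  moreover have "inj_on (iso_verts h) (pverts F)"
    using h(1) by (simp add: pre_digraph.digraph_isomorphism_def)
  ultimately show ?thesis by (simp add: card_image)
qed

theorem depth_upper_bound:
  "\<exists>\<F> :: ngraph set. infinite \<F> \<and>
     (\<forall>F\<in>\<F>. \<forall>F'\<in>\<F>. graph_iso F F' \<longrightarrow> F = F') \<and>
     (\<forall>F\<in>\<F>. connected_graph F \<and> real (D' F) \<le> 2 / 3 * real (v_count F) + 1)"
proof (intro exI[of _ "(\<lambda>a. broom (2 * a) a) ` {1..}"] conjI ballI impI)
  have "inj_on (\<lambda>a. broom (2 * a) a) {1..}"
  proof (rule inj_onI)
    fix a b assume "broom (2 * a) a = broom (2 * b) b"
    then have "v_count (broom (2 * a) a) = v_count (broom (2 * b) b)" by simp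
    then show "a = b" by (simp add: v_count_broom)
  qed
  then show "infinite ((\<lambda>a. broom (2 * a) a) ` {1..})"
    using finite_image_iff infinite_Ici[of "1 :: nat"] by blast
next
  fix F F' assume "F \<in> (\<lambda>a. broom (2 * a) a) ` {1..}" "F' \<in> (\<lambda>a. broom (2 * a) a) ` {1..}"
    "graph_iso F F'"
  then show "F = F'" using graph_iso_v_count[of F F'] by (auto simp: v_count_broom)
next
  fix F assume "F \<in> (\<lambda>a. broom (2 * a) a) ` {1..}"
  then obtain a where a: "1 \<le> a" "F = broom (2 * a) a" by auto
  then show "connected_graph F" by (simp add: connected_broom)
  have "real (D' F) \<le> real (Suc (2 * a))"
    using D'_broom_le[of "2 * a" a] a by (simp only: of_nat_le_iff)
  then show "real (D' F) \<le> 2 / 3 * real (v_count F) + 1"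
    using a(2) by (simp add: v_count_broom field_simps)
qed

theorem theorem2:
  shows "(\<exists>\<F> :: ngraph set. infinite \<F> \<and>
            (\<forall>F\<in>\<F>. \<forall>F'\<in>\<F>. graph_iso F F' \<longrightarrow> F = F') \<and>
            (\<forall>F\<in>\<F>. connected_graph F \<and> real (D' F) \<le> 2 / 3 * real (v_count F) + 1)) \<and>
         (\<forall>F :: ngraph. connected_graph F \<longrightarrow> real (W' F) > 2 / 3 * real (v_count F) - 2)"
  using depth_upper_bound width_lower_bound by blast

end
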